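(* For every infinite dimensional UHF algebra $\mathfrak{A}$ and every pure state $\omega$ on $\mathfrak{A}$, the bundle $p_{\mathsf{U}(\mathfrak{A})}:\mathsf{U}(\mathfrak{A})\to\mathscr{P}_\omega(\mathfrak{A})$, $U\mapsto U\cdot\omega$, is nontrivial.
   Context: A UHF algebra is the $C^*$-algebra colimit of a sequence $\mathfrak{A}_0\hookrightarrow\mathfrak{A}_1\hookrightarrow\cdots$ of injective unital $*$-homomorphisms with each $\mathfrak{A}_j$ $*$-isomorphic to a full matrix algebra $M_{n_j}(\mathbb{C})$, with $n_j\to\infty$. $\mathsf{U}(\mathfrak{A})$ is the unitary group with the norm topology. $U\cdot\omega$ denotes the pure state $A\mapsto\omega(U^*AU)$. $\mathscr{P}_\omega(\mathfrak{A})=\{U\cdot\omega : U\in\mathsf{U}(\mathfrak{A})\}$ is the superselection sector of $\omega$ (the set of pure states whose GNS representation is unitarily equivalent to that of $\omega$), with the topology induced by the norm of $\mathfrak{A}^*$. The map $p_{\mathsf{U}(\mathfrak{A})}$ is a locally trivial principal bundle with structure group the isotropy group $\mathsf{U}_\omega(\mathfrak{A})=\{U\in\mathsf{U}(\mathfrak{A}): U\cdot\omega=\omega\}$ acting by right multiplication. A bundle is trivial if it has a global trivialization, here a homeomorphism $\mathsf{U}(\mathfrak{A})\to\mathscr{P}_\omega(\mathfrak{A})\times\mathsf{U}_\omega(\mathfrak{A})$ over $\mathscr{P}_\omega(\mathfrak{A})$; nontrivial means not trivial. *)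

theory Defs
  imports
    "HOL-Analysis.Analysis"
    "Jordan_Normal_Form.Schur_Decomposition"
begin

section \<open>Unital C*-algebras\<close>

class cstar_algebra_1 = real_normed_algebra_1 + banach +
  fixes scaleC :: "complex \<Rightarrow> 'a \<Rightarrow> 'a" (infixr \<open>*\<^sub>C\<close> 75)
    and star :: "'a \<Rightarrow> 'a"
  assumes scaleC_add_right: "c *\<^sub>C (x + y) = c *\<^sub>C x + c *\<^sub>C y"
    and scaleC_add_left: "(c + d) *\<^sub>C x = c *\<^sub>C x + d *\<^sub>C x"
    and scaleC_scaleC: "c *\<^sub>C d *\<^sub>C x = (c * d) *\<^sub>C x"
    and scaleR_scaleC: "r *\<^sub>R x = complex_of_real r *\<^sub>C x"
    and mult_scaleC_left: "(c *\<^sub>C x) * y = c *\<^sub>C (x * y)"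
    and mult_scaleC_right: "x * (c *\<^sub>C y) = c *\<^sub>C (x * y)"
    and norm_scaleC: "norm (c *\<^sub>C x) = cmod c * norm x"
    and star_star: "star (star x) = x"
    and star_add: "star (x + y) = star x + star y"
    and star_scaleC: "star (c *\<^sub>C x) = cnj c *\<^sub>C star x"
    and star_mult: "star (x * y) = star y * star x"
    and norm_star_mult_self: "norm (star x * x) = (norm x)\<^sup>2"

lemma vector_space_scaleC:
  "vector_space (scaleC :: complex \<Rightarrow> 'a \<Rightarrow> 'a::cstar_algebra_1)"
proof
  show "1 *\<^sub>C x = x" for x :: 'a
    using scaleR_scaleC[of 1 x] by simp
qed (simp_all add: scaleC_add_right scaleC_add_left scaleC_scaleC)

definition infinite_dimensional :: "'a::cstar_algebra_1 itself \<Rightarrow> bool" where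
  "infinite_dimensional _ \<longleftrightarrow>
     \<not> (\<exists>B::'a set. finite B \<and> Modules.module.span scaleC B = UNIV)"

definition unitaries :: "'a::cstar_algebra_1 set" where
  "unitaries = {U. star U * U = 1 \<and> U * star U = 1}"

definition unital_star_hom :: "('a::cstar_algebra_1 \<Rightarrow> 'b::cstar_algebra_1) \<Rightarrow> bool" where
  "unital_star_hom f \<longleftrightarrow>
     f 1 = 1 \<and>
     (\<forall>x y. f (x + y) = f x + f y) \<and>
     (\<forall>c x. f (c *\<^sub>C x) = c *\<^sub>C f x) \<and>
     (\<forall>x y. f (x * y) = f x * f y) \<and>
     (\<forall>x. f (star x) = star (f x))"


section \<open>UHF algebras\<close>

abbreviation cmats :: "nat \<Rightarrow> complex mat set" where
  "cmats n \<equiv> carrier_mat n n"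

definition mat_unital_star_hom :: "nat \<Rightarrow> nat \<Rightarrow> (complex mat \<Rightarrow> complex mat) \<Rightarrow> bool" where
  "mat_unital_star_hom n m f \<longleftrightarrow>
     f \<in> cmats n \<rightarrow> cmats m \<and>
     f (1\<^sub>m n) = 1\<^sub>m m \<and>
     (\<forall>X\<in>cmats n. \<forall>Y\<in>cmats n. f (X + Y) = f X + f Y) \<and>
     (\<forall>c. \<forall>X\<in>cmats n. f (c \<cdot>\<^sub>m X) = c \<cdot>\<^sub>m f X) \<and>
     (\<forall>X\<in>cmats n. \<forall>Y\<in>cmats n. f (X * Y) = f X * f Y) \<and>
     (\<forall>X\<in>cmats n. f (mat_adjoint X) = mat_adjoint (f X))"

definition mat_alg_unital_star_hom :: "nat \<Rightarrow> (complex mat \<Rightarrow> 'a::cstar_algebra_1) \<Rightarrow> bool" where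
  "mat_alg_unital_star_hom n f \<longleftrightarrow>
     f (1\<^sub>m n) = 1 \<and>
     (\<forall>X\<in>cmats n. \<forall>Y\<in>cmats n. f (X + Y) = f X + f Y) \<and>
     (\<forall>c. \<forall>X\<in>cmats n. f (c \<cdot>\<^sub>m X) = c *\<^sub>C f X) \<and>
     (\<forall>X\<in>cmats n. \<forall>Y\<in>cmats n. f (X * Y) = f X * f Y) \<and>
     (\<forall>X\<in>cmats n. f (mat_adjoint X) = star (f X))"

text \<open>
  The C*-colimit of a sequence of injective unital *-homomorphisms \<open>\<phi> j\<close> is the completion of the
  algebraic direct limit, presented here by its cocone \<open>\<iota>\<close>: the \<open>\<iota> j\<close> are injective and
  compatible, so that the union of their ranges is the algebraic direct limit, and this union is
  dense.  Theorem \<open>matrix_colimit_universal\<close> below derives the universal property.  The building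
  blocks, known up to *-isomorphism only, are taken to be the matrix algebras themselves.
\<close>

definition matrix_system :: "(nat \<Rightarrow> nat) \<Rightarrow> (nat \<Rightarrow> complex mat \<Rightarrow> complex mat) \<Rightarrow> bool" where
  "matrix_system n \<phi> \<longleftrightarrow>
     (\<forall>j. mat_unital_star_hom (n j) (n (Suc j)) (\<phi> j) \<and> inj_on (\<phi> j) (cmats (n j)))"

definition matrix_cocone ::
  "(nat \<Rightarrow> nat) \<Rightarrow> (nat \<Rightarrow> complex mat \<Rightarrow> complex mat) \<Rightarrow>
   (nat \<Rightarrow> complex mat \<Rightarrow> 'a::cstar_algebra_1) \<Rightarrow> bool" where
  "matrix_cocone n \<phi> \<psi> \<longleftrightarrow>
     (\<forall>j. mat_alg_unital_star_hom (n j) (\<psi> j)) \<and>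
     (\<forall>j. \<forall>X\<in>cmats (n j). \<psi> (Suc j) (\<phi> j X) = \<psi> j X)"

definition matrix_colimit ::
  "(nat \<Rightarrow> nat) \<Rightarrow> (nat \<Rightarrow> complex mat \<Rightarrow> complex mat) \<Rightarrow>
   (nat \<Rightarrow> complex mat \<Rightarrow> 'a::cstar_algebra_1) \<Rightarrow> bool" where
  "matrix_colimit n \<phi> \<iota> \<longleftrightarrow>
     matrix_cocone n \<phi> \<iota> \<and>
     (\<forall>j. inj_on (\<iota> j) (cmats (n j))) \<and>
     closure (\<Union>j. \<iota> j ` cmats (n j)) = UNIV"

definition UHF_algebra :: "'a::cstar_algebra_1 itself \<Rightarrow> bool" where
  "UHF_algebra _ \<longleftrightarrow>
     (\<exists>n \<phi> (\<iota> :: nat \<Rightarrow> complex mat \<Rightarrow> 'a).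
        filterlim n at_top sequentially \<and> matrix_system n \<phi> \<and> matrix_colimit n \<phi> \<iota>)"


section \<open>Pure states and superselection sectors\<close>

text \<open>
  The dual of the algebra is carried by the complex-linear elements of
  \<open>'a \<Rightarrow>\<^sub>L complex\<close>; the norm of this type is the operator norm.
\<close>

definition states :: "('a::cstar_algebra_1 \<Rightarrow>\<^sub>L complex) set" where
  "states = {\<omega>. (\<forall>c x. blinfun_apply \<omega> (c *\<^sub>C x) = c * blinfun_apply \<omega> x) \<and>
                (\<forall>x. blinfun_apply \<omega> (star x * x) \<in> \<real>\<^sub>\<ge>\<^sub>0) \<and>
                blinfun_apply \<omega> 1 = 1}"

definition pure_state :: "('a::cstar_algebra_1 \<Rightarrow>\<^sub>L complex) \<Rightarrow> bool" where
  "pure_state \<omega> \<longleftrightarrow> \<omega> extreme_point_of states"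

definition act :: "'a::cstar_algebra_1 \<Rightarrow> ('a \<Rightarrow>\<^sub>L complex) \<Rightarrow> ('a \<Rightarrow>\<^sub>L complex)" where
  "act U \<omega> = Blinfun (\<lambda>x. blinfun_apply \<omega> (star U * x * U))"

lemma blinfun_apply_act [simp]:
  "blinfun_apply (act U \<omega>) x = blinfun_apply \<omega> (star U * x * U)"
proof -
  have "bounded_linear (\<lambda>x. star U * x * U)"
    by (intro bounded_linear_intros)
  then have "bounded_linear (\<lambda>x. blinfun_apply \<omega> (star U * x * U))"
    by (rule bounded_linear_compose[OF blinfun.bounded_linear_right])
  then show ?thesis
    by (simp add: act_def bounded_linear_Blinfun_apply)
qed

definition sector :: "('a::cstar_algebra_1 \<Rightarrow>\<^sub>L complex) \<Rightarrow> ('a \<Rightarrow>\<^sub>L complex) set" where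
  "sector \<omega> = (\<lambda>U. act U \<omega>) ` unitaries"

definition isotropy :: "('a::cstar_algebra_1 \<Rightarrow>\<^sub>L complex) \<Rightarrow> 'a set" where
  "isotropy \<omega> = {U \<in> unitaries. act U \<omega> = \<omega>}"

text \<open>
  A trivialization need not be equivariant for a structure group; \<open>F\<close> is the fibre.
\<close>

definition trivial_bundle ::
  "'e::topological_space set \<Rightarrow> 'b::topological_space set \<Rightarrow> 'f::topological_space set \<Rightarrow>
   ('e \<Rightarrow> 'b) \<Rightarrow> bool" where
  "trivial_bundle E B F p \<longleftrightarrow>
     (\<exists>h g. homeomorphism E (B \<times> F) h g \<and> (\<forall>e\<in>E. fst (h e) = p e))"


section \<open>Universal property of the colimit\<close>

lemma mat_alg_hom_bound:
  fixes \<iota> :: "complex mat \<Rightarrow> 'a::cstar_algebra_1" and \<psi> :: "complex mat \<Rightarrow> 'b::cstar_algebra_1"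
  assumes i: "mat_alg_unital_star_hom n \<iota>" and inj: "inj_on \<iota> (cmats n)"
    and p: "mat_alg_unital_star_hom n \<psi>"
  obtains C where "\<And>X. X \<in> cmats n \<Longrightarrow> norm (\<psi> X) \<le> C * norm (\<iota> X)"
proof -
  define E :: "nat \<times> nat \<Rightarrow> complex mat" where
    "E = (\<lambda>q. mat n n (\<lambda>r. if r = q then 1 else 0))"
  let ?I = "{..<n} \<times> {..<n}"
  have E [simp]: "E q \<in> cmats n" for q by (simp add: E_def)
  have z: "f (0\<^sub>m n n) = 0" if "mat_alg_unital_star_hom n f"
    for f :: "complex mat \<Rightarrow> 'c::cstar_algebra_1"
  proof -
    have "f (0\<^sub>m n n + 0\<^sub>m n n) = f (0\<^sub>m n n) + f (0\<^sub>m n n)"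
      using that unfolding mat_alg_unital_star_hom_def by (metis zero_carrier_mat)
    then show ?thesis by simp
  qed
  have sum: "norm (\<psi> (mat n n (\<lambda>r. if r \<in> S then x r else 0))) \<le> (\<Sum>q\<in>S. cmod (x q) * norm (\<psi> (E q)))"
    if "finite S" for S and x :: "nat \<times> nat \<Rightarrow> complex"
    using that
  proof (induction S)
    case empty
    have "mat n n (\<lambda>r. 0) = (0\<^sub>m n n :: complex mat)" by (auto intro: eq_matI)
    then show ?case using z[OF p] by simp
  next
    case (insert q S)
    have "mat n n (\<lambda>r. if r \<in> insert q S then x r else 0)
        = x q \<cdot>\<^sub>m E q + mat n n (\<lambda>r. if r \<in> S then x r else 0)"
      using insert.hyps by (auto simp: E_def intro!: eq_matI)
    then have "\<psi> (mat n n (\<lambda>r. if r \<in> insert q S then x r else 0))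
        = x q *\<^sub>C \<psi> (E q) + \<psi> (mat n n (\<lambda>r. if r \<in> S then x r else 0))"
      using p by (simp add: mat_alg_unital_star_hom_def)
    then have "norm (\<psi> (mat n n (\<lambda>r. if r \<in> insert q S then x r else 0)))
        \<le> cmod (x q) * norm (\<psi> (E q)) + norm (\<psi> (mat n n (\<lambda>r. if r \<in> S then x r else 0)))"
      using norm_triangle_ineq[of "x q *\<^sub>C \<psi> (E q)"] by (simp only: norm_scaleC)
    then show ?case using insert by simp
  qed
  have pos: "norm (\<iota> (E q)) > 0" if "q \<in> ?I" for q
  proof -
    have "E q $$ q = 1" "(0\<^sub>m n n :: complex mat) $$ q = 0" using that by (auto simp: E_def)
    then have "E q \<noteq> 0\<^sub>m n n" by auto
    then have "\<iota> (E q) \<noteq> \<iota> (0\<^sub>m n n)" using inj by (auto simp: inj_on_def)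
    then show ?thesis using z[OF i] by simp
  qed
  define K where "K q = norm (\<iota> (E (fst q, fst q))) * norm (\<iota> (E (snd q, snd q))) / norm (\<iota> (E q))"
    for q
  have entry: "cmod (X $$ q) \<le> K q * norm (\<iota> X)" if X: "X \<in> cmats n" and q: "q \<in> ?I" for X q
  proof -
    obtain a b where ab: "q = (a, b)" "a < n" "b < n" using q by auto
    have L: "E (a, a) * X = mat n n (\<lambda>(i, j). if i = a then X $$ (a, j) else 0)"
    proof (rule eq_matI, goal_cases)
      case (1 i j)
      have "(E (a, a) * X) $$ (i, j) = (\<Sum>k<n. (if i = a \<and> k = a then 1 else 0) * X $$ (k, j))"
        using 1 X by (simp add: E_def scalar_prod_def lessThan_atLeast0 if_distrib cong: if_cong)
      also have "\<dots> = (\<Sum>k<n. if k = a then (if i = a then X $$ (a, j) else 0) else 0)"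
        by (intro sum.cong) auto
      also have "\<dots> = (if i = a then X $$ (a, j) else 0)" using ab by (simp add: sum.delta)
      finally show ?case using 1 by simp
    qed (use X in \<open>auto simp: E_def\<close>)
    have R: "mat n n (\<lambda>(i, j). if i = a then X $$ (a, j) else 0) * E (b, b) = X $$ q \<cdot>\<^sub>m E q"
    proof (rule eq_matI, goal_cases)
      case (1 i j)
      have "(mat n n (\<lambda>(i, j). if i = a then X $$ (a, j) else 0) * E (b, b)) $$ (i, j)
          = (\<Sum>k<n. (if i = a then X $$ (a, k) else 0) * (if k = b \<and> j = b then 1 else 0))"
        using 1 X by (simp add: E_def scalar_prod_def lessThan_atLeast0 cong: if_cong)
      also have "\<dots> = (\<Sum>k<n. if k = b then (if i = a \<and> j = b then X $$ (a, b) else 0) else 0)"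
        by (intro sum.cong) auto
      also have "\<dots> = (if i = a \<and> j = b then X $$ (a, b) else 0)" using ab by (simp add: sum.delta)
      finally show ?case using 1 ab by (auto simp: E_def)
    qed (auto simp: E_def)
    have "X $$ q \<cdot>\<^sub>m E q = (E (a, a) * X) * E (b, b)" using L R by simp
    then have "X $$ q *\<^sub>C \<iota> (E q) = \<iota> (E (a, a)) * \<iota> X * \<iota> (E (b, b))"
      using i X unfolding mat_alg_unital_star_hom_def by (metis E mult_carrier_mat)
    then have "cmod (X $$ q) * norm (\<iota> (E q)) = norm (\<iota> (E (a, a)) * \<iota> X * \<iota> (E (b, b)))"
      by (metis norm_scaleC)
    also have "\<dots> \<le> norm (\<iota> (E (a, a)) * \<iota> X) * norm (\<iota> (E (b, b)))"
      by (rule norm_mult_ineq)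
    also have "\<dots> \<le> norm (\<iota> (E (a, a))) * norm (\<iota> X) * norm (\<iota> (E (b, b)))"
      by (intro mult_right_mono norm_mult_ineq) simp
    finally show ?thesis using pos[OF q] ab by (simp add: K_def field_simps)
  qed
  have "norm (\<psi> X) \<le> (\<Sum>q\<in>?I. K q * norm (\<psi> (E q))) * norm (\<iota> X)" if X: "X \<in> cmats n" for X
  proof -
    have "X = mat n n (\<lambda>r. if r \<in> ?I then X $$ r else 0)" using X by (auto intro!: eq_matI)
    then have "norm (\<psi> X) \<le> (\<Sum>q\<in>?I. cmod (X $$ q) * norm (\<psi> (E q)))"
      using sum[of ?I "\<lambda>r. X $$ r"] by simp
    also have "\<dots> \<le> (\<Sum>q\<in>?I. (K q * norm (\<iota> X)) * norm (\<psi> (E q)))"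
      by (intro sum_mono mult_right_mono entry X) auto
    also have "\<dots> = (\<Sum>q\<in>?I. K q * norm (\<psi> (E q))) * norm (\<iota> X)"
      by (simp add: sum_distrib_left sum_distrib_right mult_ac)
    finally show ?thesis .
  qed
  then show thesis by (rule that)
qed

lemma norm_selfadjoint_power:
  fixes a :: "'a::cstar_algebra_1"
  assumes "star a = a"
  shows "norm (a ^ 2 ^ k) = norm a ^ 2 ^ k \<and> star (a ^ 2 ^ k) = a ^ 2 ^ k"
proof (induction k)
  case (Suc k)
  have "a ^ 2 ^ Suc k = star (a ^ 2 ^ k) * a ^ 2 ^ k"
    using Suc by (simp add: power_add[symmetric] mult_2)
  then show ?case
    using Suc norm_star_mult_self[of "a ^ 2 ^ k"]
    by (simp add: star_mult star_star power_mult[symmetric] mult.commute)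
qed (use assms in simp)

lemma mat_alg_hom_contractive:
  fixes \<iota> :: "complex mat \<Rightarrow> 'a::cstar_algebra_1" and \<psi> :: "complex mat \<Rightarrow> 'b::cstar_algebra_1"
  assumes i: "mat_alg_unital_star_hom n \<iota>" and inj: "inj_on \<iota> (cmats n)"
    and p: "mat_alg_unital_star_hom n \<psi>" and X: "X \<in> cmats n"
  shows "norm (\<psi> X) \<le> norm (\<iota> X)"
proof -
  obtain C where C: "\<And>X. X \<in> cmats n \<Longrightarrow> norm (\<psi> X) \<le> C * norm (\<iota> X)"
    using mat_alg_hom_bound[OF i inj p] by blast
  define Y where "Y = mat_adjoint X * X"
  have adj: "mat_adjoint X \<in> cmats n" using X by (auto simp: mat_adjoint_def)
  then have Y: "Y \<in> cmats n" using X by (simp add: Y_def)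
  have pow: "f (Y ^\<^sub>m k) = f Y ^ k" if "mat_alg_unital_star_hom n f"
    for f :: "complex mat \<Rightarrow> 'c::cstar_algebra_1" and k
  proof (induction k)
    case 0
    then show ?case using that Y by (simp add: mat_alg_unital_star_hom_def)
  next
    case (Suc k)
    have "f (Y ^\<^sub>m k * Y) = f (Y ^\<^sub>m k) * f Y"
      using that Y pow_carrier_mat[OF Y, of k] unfolding mat_alg_unital_star_hom_def by blast
    then show ?case using Suc by (simp add: power_commutes)
  qed
  have Yeq: "f Y = star (f X) * f X" if "mat_alg_unital_star_hom n f"
    for f :: "complex mat \<Rightarrow> 'c::cstar_algebra_1"
    using that X adj unfolding mat_alg_unital_star_hom_def Y_def by simp
  have le: "norm (\<psi> Y) ^ 2 ^ k \<le> C * norm (\<iota> Y) ^ 2 ^ k" for k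
  proof -
    have "star (\<psi> Y) = \<psi> Y" "star (\<iota> Y) = \<iota> Y"
      by (simp_all add: Yeq[OF i] Yeq[OF p] star_mult star_star)
    then show ?thesis
      using C[OF pow_carrier_mat[OF Y, of "2 ^ k"]] norm_selfadjoint_power
      by (metis pow[OF i] pow[OF p])
  qed
  have "norm (\<psi> Y) \<le> norm (\<iota> Y)"
  proof (rule ccontr)
    assume "\<not> ?thesis"
    then have gt: "norm (\<psi> Y) > norm (\<iota> Y)" by simp
    show False
    proof (cases "\<iota> Y = 0")
      case True
      then show False using le[of 0] gt by simp
    next
      case False
      define r where "r = norm (\<psi> Y) / norm (\<iota> Y)"
      have r: "r > 1" using False gt by (simp add: r_def)
      have "r ^ 2 ^ k \<le> C" for k
        using le[of k] False by (simp add: r_def power_divide divide_le_eq)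
      moreover obtain m where "C < r ^ m" using real_arch_pow[OF r] by blast
      moreover have "r ^ m \<le> r ^ 2 ^ m" using r by (intro power_increasing) auto
      ultimately show False by (meson not_le order_trans)
    qed
  qed
  then have "(norm (\<psi> X))\<^sup>2 \<le> (norm (\<iota> X))\<^sup>2"
    by (simp add: Yeq[OF i] Yeq[OF p] norm_star_mult_self)
  then show ?thesis by (rule power2_le_imp_le) simp
qed

lemma norm_star: "norm (star x) = norm (x::'a::cstar_algebra_1)"
proof -
  have le: "norm y \<le> norm (star y)" for y :: 'a
  proof (cases "y = 0")
    case False
    have "norm y * norm y \<le> norm (star y) * norm y"
      using norm_star_mult_self[of y] norm_mult_ineq[of "star y" y] by (simp add: power2_eq_square)
    then show ?thesis using False by simp
  qed simp
  show ?thesis using le[of x] le[of "star x"] by (simp add: star_star)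
qed

lemma continuous_on_star: "continuous_on S (star :: 'a \<Rightarrow> 'a::cstar_algebra_1)"
proof -
  have "bounded_linear (star :: 'a \<Rightarrow> 'a)"
    by (rule bounded_linear_intro[where K = 1])
       (simp_all add: star_add scaleR_scaleC star_scaleC norm_star)
  then show ?thesis by (rule linear_continuous_on)
qed

lemma continuous_on_scaleC: "continuous_on S (\<lambda>x::'a::cstar_algebra_1. c *\<^sub>C x)"
proof -
  have "bounded_linear (\<lambda>x::'a. c *\<^sub>C x)"
    by (rule bounded_linear_intro[where K = "cmod c"])
       (simp_all add: scaleC_add_right scaleR_scaleC scaleC_scaleC norm_scaleC mult.commute)
  then show ?thesis by (rule linear_continuous_on)
qed

theorem matrix_colimit_universal:
  fixes \<iota> :: "nat \<Rightarrow> complex mat \<Rightarrow> 'a::cstar_algebra_1"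
    and \<psi> :: "nat \<Rightarrow> complex mat \<Rightarrow> 'b::cstar_algebra_1"
  assumes sys: "matrix_system n \<phi>" and colim: "matrix_colimit n \<phi> \<iota>" and cocone: "matrix_cocone n \<phi> \<psi>"
  shows "\<exists>!u. unital_star_hom u \<and> continuous_on UNIV u \<and>
              (\<forall>j. \<forall>X\<in>cmats (n j). u (\<iota> j X) = \<psi> j X)"
proof -
  have i: "mat_alg_unital_star_hom (n j) (\<iota> j)" and inj: "inj_on (\<iota> j) (cmats (n j))"
    and p: "mat_alg_unital_star_hom (n j) (\<psi> j)" for j
    using colim cocone by (auto simp: matrix_colimit_def matrix_cocone_def)
  define D where "D = (\<Union>j. \<iota> j ` cmats (n j))"
  have dense: "closure D = UNIV" using colim by (simp add: matrix_colimit_def D_def)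
  have push: "\<exists>Y\<in>cmats (n (j + k)). \<iota> (j + k) Y = \<iota> j X \<and> \<psi> (j + k) Y = \<psi> j X"
    if "X \<in> cmats (n j)" for j k X
  proof (induction k)
    case (Suc k)
    then obtain Y where Y: "Y \<in> cmats (n (j + k))" "\<iota> (j + k) Y = \<iota> j X" "\<psi> (j + k) Y = \<psi> j X"
      by blast
    have "\<phi> (j + k) Y \<in> cmats (n (j + Suc k))"
      using sys Y(1) by (auto simp: matrix_system_def mat_unital_star_hom_def)
    moreover have "\<iota> (j + Suc k) (\<phi> (j + k) Y) = \<iota> j X" "\<psi> (j + Suc k) (\<phi> (j + k) Y) = \<psi> j X"
      using colim cocone Y by (simp_all add: matrix_colimit_def matrix_cocone_def)
    ultimately show ?case by blast
  qed (use that in auto)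
  define u0 where "u0 x = (SOME y. \<exists>j. \<exists>X\<in>cmats (n j). x = \<iota> j X \<and> y = \<psi> j X)" for x
  have common: "\<exists>m X' Y'. X' \<in> cmats (n m) \<and> Y' \<in> cmats (n m) \<and> \<iota> m X' = \<iota> j X \<and> \<psi> m X' = \<psi> j X
      \<and> \<iota> m Y' = \<iota> k Y \<and> \<psi> m Y' = \<psi> k Y"
    if "X \<in> cmats (n j)" "Y \<in> cmats (n k)" for j k X Y
    using push[OF that(1), of k] push[OF that(2), of j] by (metis add.commute)
  have u0: "u0 (\<iota> j X) = \<psi> j X" if X: "X \<in> cmats (n j)" for j X
  proof -
    have "y = \<psi> j X" if "\<exists>k. \<exists>Y\<in>cmats (n k). \<iota> j X = \<iota> k Y \<and> y = \<psi> k Y" for y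
    proof -
      obtain k Y where Y: "Y \<in> cmats (n k)" "\<iota> j X = \<iota> k Y" "y = \<psi> k Y"
        using \<open>\<exists>k. \<exists>Y\<in>cmats (n k). \<iota> j X = \<iota> k Y \<and> y = \<psi> k Y\<close> by blast
      obtain m X' Y' where "X' \<in> cmats (n m)" "Y' \<in> cmats (n m)" "\<iota> m X' = \<iota> j X" "\<psi> m X' = \<psi> j X"
        "\<iota> m Y' = \<iota> k Y" "\<psi> m Y' = \<psi> k Y"
        using common[OF X Y(1)] by blast
      then show ?thesis using Y inj[of m] by (metis inj_onD)
    qed
    then show ?thesis unfolding u0_def using X by (intro some_equality) auto
  qed
  have inD: "\<iota> j X \<in> D" if "X \<in> cmats (n j)" for j X
    using that by (auto simp: D_def)
  have two: "\<exists>m X Y. X \<in> cmats (n m) \<and> Y \<in> cmats (n m) \<and> x = \<iota> m X \<and> y = \<iota> m Y"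
    if "x \<in> D" "y \<in> D" for x y
    using that common unfolding D_def by (smt (verit) UN_E imageE)
  have add0: "x + y \<in> D \<and> u0 (x + y) = u0 x + u0 y"
    and mult0: "x * y \<in> D \<and> u0 (x * y) = u0 x * u0 y" if xy: "x \<in> D" "y \<in> D" for x y
  proof -
    obtain m X Y where XY: "X \<in> cmats (n m)" "Y \<in> cmats (n m)" "x = \<iota> m X" "y = \<iota> m Y"
      using two[OF xy] by blast
    have "\<iota> m (X + Y) = x + y" "\<iota> m (X * Y) = x * y" "\<psi> m (X + Y) = \<psi> m X + \<psi> m Y"
      "\<psi> m (X * Y) = \<psi> m X * \<psi> m Y"
      using i[of m] p[of m] XY by (auto simp: mat_alg_unital_star_hom_def)
    moreover have "X + Y \<in> cmats (n m)" "X * Y \<in> cmats (n m)" using XY by auto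
    ultimately show "x + y \<in> D \<and> u0 (x + y) = u0 x + u0 y" "x * y \<in> D \<and> u0 (x * y) = u0 x * u0 y"
      using inD[of "X + Y" m] inD[of "X * Y" m] u0[of "X + Y" m] u0[of "X * Y" m]
        u0[OF XY(1)] u0[OF XY(2)] XY(3,4) by simp_all
  qed
  have scale0: "c *\<^sub>C x \<in> D \<and> u0 (c *\<^sub>C x) = c *\<^sub>C u0 x"
    and star0: "star x \<in> D \<and> u0 (star x) = star (u0 x)" and norm0: "norm (u0 x) \<le> norm x"
    if x: "x \<in> D" for x c
  proof -
    obtain m X where X: "X \<in> cmats (n m)" "x = \<iota> m X" using x unfolding D_def by blast
    have "\<iota> m (c \<cdot>\<^sub>m X) = c *\<^sub>C x" "\<iota> m (mat_adjoint X) = star x" "\<psi> m (c \<cdot>\<^sub>m X) = c *\<^sub>C \<psi> m X"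
      "\<psi> m (mat_adjoint X) = star (\<psi> m X)"
      using i[of m] p[of m] X by (auto simp: mat_alg_unital_star_hom_def)
    moreover have "c \<cdot>\<^sub>m X \<in> cmats (n m)" "mat_adjoint X \<in> cmats (n m)"
      using X by (auto simp: mat_adjoint_def)
    ultimately show "c *\<^sub>C x \<in> D \<and> u0 (c *\<^sub>C x) = c *\<^sub>C u0 x"
      "star x \<in> D \<and> u0 (star x) = star (u0 x)"
      using inD[of "c \<cdot>\<^sub>m X" m] inD[of "mat_adjoint X" m] u0[of "c \<cdot>\<^sub>m X" m]
        u0[of "mat_adjoint X" m] u0[OF X(1)] X(2) by simp_all
    show "norm (u0 x) \<le> norm x"
      using mat_alg_hom_contractive[OF i inj p X(1)] u0[OF X(1)] X(2) by simp
  qed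
  have one0: "1 \<in> D \<and> u0 1 = 1"
  proof -
    have "\<iota> 0 (1\<^sub>m (n 0)) = 1" "\<psi> 0 (1\<^sub>m (n 0)) = 1" "1\<^sub>m (n 0) \<in> cmats (n 0)"
      using i[of 0] p[of 0] by (auto simp: mat_alg_unital_star_hom_def)
    then show ?thesis using u0[of "1\<^sub>m (n 0)" 0] inD[of "1\<^sub>m (n 0)" 0] by simp
  qed
  have minus0: "dist (u0 x) (u0 y) \<le> dist x y" if "x \<in> D" "y \<in> D" for x y
  proof -
    have m: "-1 *\<^sub>C z = - z" for z :: "'c::cstar_algebra_1"
      using scaleR_scaleC[of "-1" z] by simp
    have "u0 (x - y) = u0 x - u0 y" "x - y \<in> D"
      using scale0[OF that(2), of "-1"] add0[OF that(1), of "- y"] by (simp_all add: m)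
    then show ?thesis using norm0[of "x - y"] by (simp add: dist_norm)
  qed
  have "uniformly_continuous_on D u0"
    unfolding uniformly_continuous_on_def
  proof (intro allI impI exI conjI ballI)
    show "dist (u0 y) (u0 x) < e" if "x \<in> D" "y \<in> D" "dist y x < e" for x y e
      using minus0[OF that(2,1)] that(3) by simp
  qed simp
  then obtain u where "uniformly_continuous_on (closure D) u" and uext: "\<And>x. x \<in> D \<Longrightarrow> u0 x = u x"
    by (rule uniformly_continuous_on_extension_on_closure) blast
  then have cont: "continuous_on UNIV u"
    using dense uniformly_continuous_imp_continuous by metis
  note comp = continuous_on_compose2[OF cont _ subset_UNIV]
  have agree: "f x = g x" if "continuous_on UNIV f" "continuous_on UNIV g" "\<And>x. x \<in> D \<Longrightarrow> f x = g x"
    for f g :: "'a \<Rightarrow> 'b" and x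
  proof -
    have "closed {x. f x = g x}" using that by (intro closed_Collect_eq)
    then have "closure D \<subseteq> {x. f x = g x}" using that by (intro closure_minimal) auto
    then show ?thesis using dense by auto
  qed
  have add1: "u (x + y) = u x + u y" if y: "y \<in> D" for x y
    by (rule agree[of "\<lambda>x. u (x + y)" "\<lambda>x. u x + u y"])
       (use add0[OF _ y] y in \<open>auto intro!: continuous_intros comp cont simp flip: uext\<close>)
  have add: "u (x + y) = u x + u y" for x y
    by (rule agree[of "\<lambda>y. u (x + y)" "\<lambda>y. u x + u y"])
       (auto intro!: continuous_intros comp cont add1)
  have mult1: "u (x * y) = u x * u y" if y: "y \<in> D" for x y
    by (rule agree[of "\<lambda>x. u (x * y)" "\<lambda>x. u x * u y"])
       (use mult0[OF _ y] y in \<open>auto intro!: continuous_intros comp cont simp flip: uext\<close>)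
  have mult: "u (x * y) = u x * u y" for x y
    by (rule agree[of "\<lambda>y. u (x * y)" "\<lambda>y. u x * u y"])
       (auto intro!: continuous_intros comp cont mult1)
  have scale: "u (c *\<^sub>C x) = c *\<^sub>C u x" for c x
  proof (rule agree[of "\<lambda>x. u (c *\<^sub>C x)" "\<lambda>x. c *\<^sub>C u x"])
    show "continuous_on UNIV (\<lambda>x. u (c *\<^sub>C x))" by (rule comp[OF continuous_on_scaleC])
    show "continuous_on UNIV (\<lambda>x. c *\<^sub>C u x)"
      by (rule continuous_on_compose2[OF continuous_on_scaleC cont subset_UNIV])
    show "u (c *\<^sub>C y) = c *\<^sub>C u y" if "y \<in> D" for y
      using scale0[OF that, of c] that by (simp flip: uext)
  qed
  have star: "u (star x) = star (u x)" for x
  proof (rule agree[of "\<lambda>x. u (star x)" "\<lambda>x. star (u x)"])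
    show "continuous_on UNIV (\<lambda>x. u (star x))" by (rule comp[OF continuous_on_star])
    show "continuous_on UNIV (\<lambda>x. star (u x))"
      by (rule continuous_on_compose2[OF continuous_on_star cont subset_UNIV])
    show "u (star y) = star (u y)" if "y \<in> D" for y
      using star0[OF that] that by (simp flip: uext)
  qed
  have ui: "u (\<iota> j X) = \<psi> j X" if "X \<in> cmats (n j)" for j X
    using u0[OF that] uext[OF inD[OF that]] by simp
  have "u 1 = 1" using one0 uext by metis
  then have "unital_star_hom u"
    using add mult scale star by (simp add: unital_star_hom_def)
  moreover have "v = u" if "continuous_on UNIV v" "\<forall>j. \<forall>X\<in>cmats (n j). v (\<iota> j X) = \<psi> j X" for v
    by (rule ext, rule agree[OF that(1) cont]) (use that(2) ui in \<open>auto simp: D_def\<close>)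
  ultimately show ?thesis using cont ui by blast
qed

end

theory Submission
  imports Defs
begin

text \<open>
  The invariant that separates the two sides of a trivialization is the degree of a continuous
  function \<open>f\<close> from the unitary group to the punctured plane along a loop of unitaries, that is, the
  winding number of the composite about 0.

  In a UHF algebra every such degree is 0 (\<open>UHF_unitary_loop_degree_0\<close>).  A loop can be moved into a
  matrix algebra \<open>A\<^sub>j\<close> without changing its degree.  For \<open>m \<ge> j\<close> the commutant of \<open>A\<^sub>j\<close> in \<open>A\<^sub>m\<close> contains
  a full system of \<open>r \<times> r\<close> matrix units, where \<open>r = n\<^sub>m / n\<^sub>j\<close>; its diagonal projections \<open>p\<^sub>a\<close> cut the
  loop \<open>\<gamma>\<close> into a product of commuting loops \<open>\<gamma> p\<^sub>a + (1 - p\<^sub>a)\<close>.  These factors are conjugate to each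
  other by unitaries that are joined to 1, so they have the same degree, and the degree of \<open>\<gamma>\<close> is
  divisible by \<open>r\<close>.  Since \<open>r\<close> is arbitrarily large, the degree is 0.  This is an elementary form
  of the fact that the fundamental group of the unitary group, a subgroup of the rationals that is
  divisible by arbitrarily large numbers, has no nonzero homomorphism to the integers.

  The isotropy group of a pure state \<open>\<omega>\<close>, on the other hand, contains the circle of scalars, and
  \<open>\<omega>\<close> itself maps the isotropy group to the punctured plane (\<open>isotropy_nonzero\<close>), with degree 1 along
  that circle.  A trivialization would exhibit the isotropy group as a factor of the unitary group:
  \<open>\<omega>\<close> after the projection to this factor is a function on the unitary group, and the circle in a
  fibre is a loop of unitaries along which it has degree 1.
\<close>

section \<open>Degrees of loops in the punctured plane\<close>

text \<open>
  The winding number about 0 of a loop that is only continuous, read off from a continuous logarithm.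
\<close>

definition has_degree :: "(real \<Rightarrow> complex) \<Rightarrow> int \<Rightarrow> bool" where
  "has_degree c d \<longleftrightarrow>
     (\<exists>g. continuous_on {0..1} g \<and> (\<forall>t\<in>{0..1}. c t = exp (g t)) \<and>
          g 1 = g 0 + 2 * pi * \<i> * of_int d)"

text \<open>
  The difference of two logarithms of the same function takes its values in the discrete set
  \<open>2 \<pi> \<i> \<int>\<close>.  All invariance properties of the degree come from this.
\<close>

lemma exp_eq_imp_constant_difference:
  fixes g h :: "'a::topological_space \<Rightarrow> complex"
  assumes S: "connected S" and g: "continuous_on S g" and h: "continuous_on S h"
    and eq: "\<And>x. x \<in> S \<Longrightarrow> exp (g x) = exp (h x)"
    and "x \<in> S" "y \<in> S"
  shows "g x - h x = g y - h y"
proof -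
  have two_pi: "\<exists>n::int. g x - h x = 2 * pi * \<i> * of_int n" if "x \<in> S" for x
    using eq[OF that] by (auto simp: exp_eq algebra_simps)
  have "(\<lambda>x. g x - h x) constant_on S"
  proof (rule continuous_discrete_range_constant[OF S])
    show "continuous_on S (\<lambda>x. g x - h x)" by (intro continuous_intros g h)
    show "\<exists>e>0. \<forall>y. y \<in> S \<and> g y - h y \<noteq> g x - h x \<longrightarrow> e \<le> norm (g y - h y - (g x - h x))"
      if x: "x \<in> S" for x
    proof (intro exI[of _ "2 * pi"] conjI allI impI)
      fix y assume y: "y \<in> S \<and> g y - h y \<noteq> g x - h x"
      obtain m n :: int where mn: "g x - h x = 2 * pi * \<i> * of_int n" "g y - h y = 2 * pi * \<i> * of_int m"
        using two_pi x y by meson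
      then have "m - n \<noteq> 0" using y by auto
      then have "1 \<le> \<bar>real_of_int (m - n)\<bar>" by linarith
      moreover have "g y - h y - (g x - h x) = 2 * pi * \<i> * of_int (m - n)"
        unfolding mn by (simp add: algebra_simps)
      then have "norm (g y - h y - (g x - h x)) = 2 * pi * \<bar>real_of_int (m - n)\<bar>"
        by (simp only: norm_mult norm_of_real norm_ii norm_of_int) simp
      ultimately show "2 * pi \<le> norm (g y - h y - (g x - h x))" by simp
    qed simp
  qed
  then show ?thesis using assms(5,6) by (auto simp: constant_on_def)
qed

lemma has_degree_unique:
  assumes "has_degree c d" "has_degree c e"
  shows "d = e"
proof -
  obtain g h where "continuous_on {0..1} g" "continuous_on {0..1} h"
    and eq: "\<And>t. t \<in> {0..1} \<Longrightarrow> c t = exp (g t)" "\<And>t. t \<in> {0..1} \<Longrightarrow> c t = exp (h t)"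
    and ends: "g 1 = g 0 + 2 * pi * \<i> * of_int d" "h 1 = h 0 + 2 * pi * \<i> * of_int e"
    using assms unfolding has_degree_def by metis
  then have "g 1 - h 1 = g 0 - h 0"
    by (intro exp_eq_imp_constant_difference[of "{0..1::real}"]) auto
  then show ?thesis using ends by auto
qed

lemma has_degree_cong:
  assumes "has_degree c d" "\<And>t. t \<in> {0..1} \<Longrightarrow> c t = c' t"
  shows "has_degree c' d"
  using assms unfolding has_degree_def by auto

lemma continuous_logarithm_on_square:
  fixes \<Phi> :: "real \<times> real \<Rightarrow> complex"
  assumes "continuous_on ({0..1} \<times> {0..1}) \<Phi>" "\<And>p. p \<in> {0..1} \<times> {0..1} \<Longrightarrow> \<Phi> p \<noteq> 0"
  obtains \<phi> where "continuous_on ({0..1} \<times> {0..1}) \<phi>"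
    "\<And>s t. s \<in> {0..1} \<Longrightarrow> t \<in> {0..1} \<Longrightarrow> \<Phi> (s, t) = exp (\<phi> (s, t))"
proof -
  have "contractible ({0..1::real} \<times> {0..1::real})"
    by (intro convex_imp_contractible convex_Times convex_real_interval)
  from continuous_logarithm_on_contractible[OF assms(1) this assms(2)]
  show thesis using that by (metis SigmaI)
qed

lemma has_degree_exists:
  assumes c: "continuous_on {0..1} c" and nz: "\<And>t. t \<in> {0..1} \<Longrightarrow> c t \<noteq> 0" and loop: "c 0 = c 1"
  obtains d where "has_degree c d"
proof -
  have "contractible {0..1::real}" by (intro convex_imp_contractible convex_real_interval)
  from continuous_logarithm_on_contractible[OF c this nz]
  obtain g where g: "continuous_on {0..1} g" "\<And>t. t \<in> {0..1} \<Longrightarrow> c t = exp (g t)" by blast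
  then have "exp (g 1) = exp (g 0)" using loop by simp
  then obtain d :: int where "g 1 = g 0 + 2 * pi * \<i> * of_int d" by (auto simp: exp_eq algebra_simps)
  then show thesis using that g unfolding has_degree_def by blast
qed

text \<open>
  For a logarithm \<open>\<phi>\<close> on the whole square, \<open>\<phi> (s, 1)\<close> and \<open>\<phi> (s, 0)\<close> are logarithms of the same function
  of \<open>s\<close>, so their difference, \<open>2 \<pi> \<i>\<close> times the degree of the \<open>s\<close>-th loop, does not depend on \<open>s\<close>.
\<close>

lemma has_degree_homotopy:
  fixes \<Phi> :: "real \<times> real \<Rightarrow> complex"
  assumes cont: "continuous_on ({0..1} \<times> {0..1}) \<Phi>" and nz: "\<And>p. p \<in> {0..1} \<times> {0..1} \<Longrightarrow> \<Phi> p \<noteq> 0"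
    and loop: "\<And>s. s \<in> {0..1} \<Longrightarrow> \<Phi> (s, 0) = \<Phi> (s, 1)"
    and d: "has_degree (\<lambda>t. \<Phi> (0, t)) d"
  shows "has_degree (\<lambda>t. \<Phi> (1, t)) d"
proof -
  obtain \<phi> where \<phi>: "continuous_on ({0..1} \<times> {0..1}) \<phi>"
    "\<And>s t. s \<in> {0..1} \<Longrightarrow> t \<in> {0..1} \<Longrightarrow> \<Phi> (s, t) = exp (\<phi> (s, t))"
    using continuous_logarithm_on_square[OF cont nz] by blast
  have row: "continuous_on {0..1} (\<lambda>t. \<phi> (s, t))" and col: "continuous_on {0..1} (\<lambda>t. \<phi> (t, s))"
    if "s \<in> {0..1}" for s
    using that by (auto intro!: continuous_on_compose2[OF \<phi>(1)] continuous_intros)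
  have "exp (\<phi> (0, 1)) = exp (\<phi> (0, 0))" using loop[of 0] \<phi>(2)[of 0 0] \<phi>(2)[of 0 1] by simp
  then obtain e :: int where e: "\<phi> (0, 1) = \<phi> (0, 0) + 2 * pi * \<i> * of_int e"
    by (auto simp: exp_eq algebra_simps)
  have "has_degree (\<lambda>t. \<Phi> (0, t)) e"
    unfolding has_degree_def using row[of 0] e \<phi>(2) by (intro exI[of _ "\<lambda>t. \<phi> (0, t)"]) auto
  then have "e = d" using d has_degree_unique by blast
  have "\<phi> (1, 1) - \<phi> (1, 0) = \<phi> (0, 1) - \<phi> (0, 0)"
    by (rule exp_eq_imp_constant_difference[of "{0..1::real}" "\<lambda>s. \<phi> (s, 1)" "\<lambda>s. \<phi> (s, 0)"])
       (use col \<phi>(2) loop in auto)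
  then have "\<phi> (1, 1) = \<phi> (1, 0) + 2 * pi * \<i> * of_int d" using e \<open>e = d\<close> by (simp add: algebra_simps)
  then show ?thesis
    unfolding has_degree_def using row[of 1] \<phi>(2) by (intro exI[of _ "\<lambda>t. \<phi> (1, t)"]) auto
qed

text \<open>
  A logarithm on the square grows along the diagonal by its increment along the edge \<open>t = 0\<close> plus that
  along the edge \<open>s = 1\<close>, and the latter is the same as along \<open>s = 0\<close>, as in the previous proof.  For
  \<open>\<Phi> (s, t) = f (\<alpha> s * \<beta> t)\<close> this makes the degree additive on pointwise products of loops.
\<close>

lemma has_degree_diagonal:
  fixes \<Phi> :: "real \<times> real \<Rightarrow> complex"
  assumes cont: "continuous_on ({0..1} \<times> {0..1}) \<Phi>" and nz: "\<And>p. p \<in> {0..1} \<times> {0..1} \<Longrightarrow> \<Phi> p \<noteq> 0"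
    and torus: "\<And>s. s \<in> {0..1} \<Longrightarrow> \<Phi> (s, 0) = \<Phi> (s, 1)"
    and d: "has_degree (\<lambda>s. \<Phi> (s, 0)) d" and e: "has_degree (\<lambda>t. \<Phi> (0, t)) e"
  shows "has_degree (\<lambda>t. \<Phi> (t, t)) (d + e)"
proof -
  obtain \<phi> where \<phi>: "continuous_on ({0..1} \<times> {0..1}) \<phi>"
    "\<And>s t. s \<in> {0..1} \<Longrightarrow> t \<in> {0..1} \<Longrightarrow> \<Phi> (s, t) = exp (\<phi> (s, t))"
    using continuous_logarithm_on_square[OF cont nz] by blast
  have \<phi>_path: "continuous_on {0..1} (\<lambda>t. \<phi> (p t, q t))"
    if "continuous_on {0..1} p" "continuous_on {0..1} q" "p ` {0..1} \<subseteq> {0..1}" "q ` {0..1} \<subseteq> {0..1}"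
    for p q :: "real \<Rightarrow> real"
    using that by (auto intro!: continuous_on_compose2[OF \<phi>(1)] continuous_intros)
  have \<phi>_loop: "\<phi> (p 1, q 1) = \<phi> (p 0, q 0) + 2 * pi * \<i> * of_int k"
    if pq: "continuous_on {0..1} p" "continuous_on {0..1} q" "p ` {0..1} \<subseteq> {0..1}" "q ` {0..1} \<subseteq> {0..1}"
      and k: "has_degree (\<lambda>t. \<Phi> (p t, q t)) k"
    for p q :: "real \<Rightarrow> real" and k
  proof -
    obtain g where g: "continuous_on {0..1} g" "\<And>t. t \<in> {0..1} \<Longrightarrow> \<Phi> (p t, q t) = exp (g t)"
      "g 1 = g 0 + 2 * pi * \<i> * of_int k"
      using k unfolding has_degree_def by blast
    have "\<phi> (p 1, q 1) - g 1 = \<phi> (p 0, q 0) - g 0"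
      by (rule exp_eq_imp_constant_difference[of "{0..1::real}" "\<lambda>t. \<phi> (p t, q t)" g])
         (use g \<phi>_path[OF pq] \<phi>(2) pq(3,4) in \<open>auto simp: image_subset_iff\<close>)
    then show ?thesis using g(3) by (simp add: algebra_simps)
  qed
  have "\<phi> (1, 0) = \<phi> (0, 0) + 2 * pi * \<i> * of_int d"
    using \<phi>_loop[of "\<lambda>t. t" "\<lambda>t. 0" d] d by (simp add: image_subset_iff)
  moreover have "\<phi> (0, 1) = \<phi> (0, 0) + 2 * pi * \<i> * of_int e"
    using \<phi>_loop[of "\<lambda>t. 0" "\<lambda>t. t" e] e by (simp add: image_subset_iff)
  moreover have "\<phi> (1, 1) - \<phi> (1, 0) = \<phi> (0, 1) - \<phi> (0, 0)"
    by (rule exp_eq_imp_constant_difference[of "{0..1::real}" "\<lambda>s. \<phi> (s, 1)" "\<lambda>s. \<phi> (s, 0)"])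
       (use \<phi>(2) torus \<phi>_path[of "\<lambda>t. t" "\<lambda>t. 0"] \<phi>_path[of "\<lambda>t. t" "\<lambda>t. 1"] in \<open>auto simp: image_subset_iff\<close>)
  ultimately have "\<phi> (1, 1) = \<phi> (0, 0) + 2 * pi * \<i> * of_int (d + e)" by (simp add: algebra_simps)
  moreover have "continuous_on {0..1} (\<lambda>t. \<phi> (t, t))" using \<phi>_path[of "\<lambda>t. t" "\<lambda>t. t"] by auto
  ultimately show ?thesis
    unfolding has_degree_def using \<phi>(2) by (intro exI[of _ "\<lambda>t. \<phi> (t, t)"]) auto
qed

text \<open>
  The straight line from \<open>c t\<close> to \<open>c' t\<close> misses 0, so the linear homotopy applies.
\<close>

lemma has_degree_close:
  assumes c: "continuous_on {0..1} c" and c': "continuous_on {0..1} c'" and loops: "c 0 = c 1" "c' 0 = c' 1"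
    and close: "\<And>t. t \<in> {0..1} \<Longrightarrow> norm (c' t - c t) < norm (c t)"
    and d: "has_degree c d"
  shows "has_degree c' d"
proof -
  define \<Phi> where "\<Phi> = (\<lambda>(s, t). c t + complex_of_real s * (c' t - c t))"
  have "has_degree (\<lambda>t. \<Phi> (1, t)) d"
  proof (rule has_degree_homotopy)
    show "continuous_on ({0..1} \<times> {0..1}) \<Phi>"
      unfolding \<Phi>_def case_prod_beta
      by (intro continuous_intros continuous_on_compose2[OF c] continuous_on_compose2[OF c']) auto
    show "\<Phi> p \<noteq> 0" if p: "p \<in> {0..1} \<times> {0..1}" for p
    proof
      assume "\<Phi> p = 0"
      then have "c (snd p) = - (complex_of_real (fst p) * (c' (snd p) - c (snd p)))"
        by (simp add: \<Phi>_def case_prod_beta add_eq_0_iff2)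
      then have "norm (c (snd p)) = \<bar>fst p\<bar> * norm (c' (snd p) - c (snd p))"
        by (metis norm_minus_cancel norm_mult norm_of_real)
      also have "\<dots> \<le> 1 * norm (c' (snd p) - c (snd p))"
        using p by (intro mult_right_mono) auto
      finally show False using close[of "snd p"] p by auto
    qed
  qed (use loops d in \<open>auto simp: \<Phi>_def\<close>)
  then show ?thesis by (simp add: \<Phi>_def)
qed

lemma has_degree_cis: "has_degree (\<lambda>t. exp (2 * pi * \<i> * complex_of_real t)) 1"
  unfolding has_degree_def
  by (intro exI[of _ "\<lambda>t. 2 * pi * \<i> * complex_of_real t"] conjI ballI continuous_intros) auto

section \<open>Polar decomposition near the unitary group\<close>

text \<open>
  The coefficients of the binomial series of \<open>(1 - y)\<close> to the power \<open>-1/2\<close>.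
\<close>

definition invsqrt_coeff :: "nat \<Rightarrow> real" where
  "invsqrt_coeff n = pochhammer (1 / 2) n / fact n"

definition invsqrt :: "'a::{real_normed_algebra_1,banach} \<Rightarrow> 'a" where
  "invsqrt y = (\<Sum>n. invsqrt_coeff n *\<^sub>R y ^ n)"

lemma invsqrt_coeff_nonneg: "0 \<le> invsqrt_coeff n"
  by (simp add: invsqrt_coeff_def pochhammer_nonneg)

lemma invsqrt_coeff_0 [simp]: "invsqrt_coeff 0 = 1"
  by (simp add: invsqrt_coeff_def)

text \<open>
  Vandermonde's identity: the Cauchy square of the series is the geometric series.
\<close>

lemma invsqrt_coeff_convolution: "(\<Sum>i\<le>n. invsqrt_coeff i * invsqrt_coeff (n - i)) = 1"
proof -
  have c: "invsqrt_coeff i = (- 1) ^ i * ((- 1 / 2) gchoose i)" for i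
    by (simp add: invsqrt_coeff_def gbinomial_pochhammer power_mult_distrib[symmetric])
  have "(\<Sum>i\<le>n. invsqrt_coeff i * invsqrt_coeff (n - i))
      = (\<Sum>i\<le>n. (- 1) ^ n * (((- 1 / 2) gchoose i) * ((- 1 / 2) gchoose (n - i))))"
    by (intro sum.cong) (auto simp: c power_add[symmetric] algebra_simps)
  also have "\<dots> = (- 1) ^ n * ((- 1 / 2 + - 1 / 2 :: real) gchoose n)"
    by (simp only: sum_distrib_left[symmetric] gbinomial_Vandermonde[symmetric] atLeast0AtMost)
  also have "\<dots> = 1"
    by (simp add: gbinomial_pochhammer power_mult_distrib[symmetric] pochhammer_fact[symmetric])
  finally show ?thesis .
qed

lemma invsqrt_coeff_le_1: "invsqrt_coeff n \<le> 1"
proof -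
  have "invsqrt_coeff n * invsqrt_coeff (n - n) \<le> (\<Sum>i\<le>n. invsqrt_coeff i * invsqrt_coeff (n - i))"
    by (rule member_le_sum) (auto simp: invsqrt_coeff_nonneg)
  then show ?thesis by (simp add: invsqrt_coeff_convolution)
qed

lemma norm_invsqrt_term: "norm (invsqrt_coeff n *\<^sub>R y ^ n) \<le> norm y ^ n"
  for y :: "'a::real_normed_algebra_1"
proof -
  have "norm (invsqrt_coeff n *\<^sub>R y ^ n) \<le> 1 * norm (y ^ n)"
    using invsqrt_coeff_nonneg[of n] invsqrt_coeff_le_1[of n]
    by (simp only: norm_scaleR abs_of_nonneg) (intro mult_right_mono, auto)
  then show ?thesis using norm_power_ineq[of y n] by simp
qed

lemma summable_norm_invsqrt:
  fixes y :: "'a::{real_normed_algebra_1,banach}"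
  assumes "norm y < 1"
  shows "summable (\<lambda>n. norm (invsqrt_coeff n *\<^sub>R y ^ n))"
  by (rule summable_comparison_test[OF _ summable_geometric[of "norm y"]])
     (use assms norm_invsqrt_term[of _ y] in auto)

lemmas summable_invsqrt = summable_norm_cancel[OF summable_norm_invsqrt]

lemma invsqrt_0 [simp]: "invsqrt (0::'a::{real_normed_algebra_1,banach}) = 1"
  using suminf_finite[of "{0}" "\<lambda>n. invsqrt_coeff n *\<^sub>R (0::'a) ^ n"]
  by (simp add: invsqrt_def power_0_left)

lemma invsqrt_square:
  fixes y :: "'a::{real_normed_algebra_1,banach}"
  assumes y: "norm y < 1"
  shows "invsqrt y * invsqrt y * (1 - y) = 1"
proof -
  have "(\<lambda>k. \<Sum>i\<le>k. (invsqrt_coeff i *\<^sub>R y ^ i) * (invsqrt_coeff (k - i) *\<^sub>R y ^ (k - i)))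
      sums (invsqrt y * invsqrt y)"
    unfolding invsqrt_def by (intro Cauchy_product_sums summable_norm_invsqrt y)
  moreover have "(\<Sum>i\<le>k. (invsqrt_coeff i *\<^sub>R y ^ i) * (invsqrt_coeff (k - i) *\<^sub>R y ^ (k - i))) = y ^ k" for k
  proof -
    have "(\<Sum>i\<le>k. (invsqrt_coeff i *\<^sub>R y ^ i) * (invsqrt_coeff (k - i) *\<^sub>R y ^ (k - i)))
        = (\<Sum>i\<le>k. (invsqrt_coeff i * invsqrt_coeff (k - i)) *\<^sub>R y ^ k)"
      by (intro sum.cong) (auto simp: power_add[symmetric])
    then show ?thesis by (simp add: scaleR_sum_left[symmetric] invsqrt_coeff_convolution)
  qed
  ultimately have "(\<lambda>k. y ^ k) sums (invsqrt y * invsqrt y)" by simp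
  then have "(\<lambda>k. y ^ k * (1 - y)) sums (invsqrt y * invsqrt y * (1 - y))" by (rule sums_mult2)
  moreover have "(\<lambda>k. y ^ k - y ^ Suc k) sums (y ^ 0 - 0)"
    by (intro telescope_sums' LIMSEQ_power_zero y)
  then have "(\<lambda>k. y ^ k * (1 - y)) sums 1" by (simp add: algebra_simps power_commutes)
  ultimately show ?thesis by (rule sums_unique2)
qed

text \<open>
  The inverse square root is a limit of polynomials in \<open>y\<close>.
\<close>

lemma invsqrt_commute:
  fixes y :: "'a::{real_normed_algebra_1,banach}"
  assumes y: "norm y < 1" and c: "b * y = y * b"
  shows "b * invsqrt y = invsqrt y * b"
proof -
  have "b * invsqrt y = (\<Sum>n. b * (invsqrt_coeff n *\<^sub>R y ^ n))"
    unfolding invsqrt_def by (rule suminf_mult[symmetric, OF summable_invsqrt[OF y]])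
  also have "\<dots> = (\<Sum>n. (invsqrt_coeff n *\<^sub>R y ^ n) * b)"
    using power_commuting_commutes[of y b] c by simp
  also have "\<dots> = invsqrt y * b"
    unfolding invsqrt_def by (rule suminf_mult2[symmetric, OF summable_invsqrt[OF y]])
  finally show ?thesis .
qed

lemma continuous_on_invsqrt:
  fixes S :: "'a::{real_normed_algebra_1,banach} set"
  assumes r: "r < 1" and S: "S \<subseteq> cball 0 r"
  shows "continuous_on S invsqrt"
proof -
  have "uniform_limit S (\<lambda>n y. \<Sum>i<n. invsqrt_coeff i *\<^sub>R y ^ i) invsqrt sequentially"
    unfolding invsqrt_def
  proof (rule Weierstrass_m_test)
    show "norm (invsqrt_coeff n *\<^sub>R y ^ n) \<le> (max 0 r) ^ n" if "y \<in> S" for n and y :: 'a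
    proof -
      have "norm y \<le> max 0 r" using that S by auto
      then have "norm y ^ n \<le> (max 0 r) ^ n" by (intro power_mono) auto
      then show ?thesis using norm_invsqrt_term[of n y] by linarith
    qed
    show "summable (\<lambda>n. (max 0 r) ^ n)" using r by (intro summable_geometric) auto
  qed
  then show ?thesis
    by (rule uniform_limit_theorem[rotated]) (auto intro!: always_eventually continuous_intros)
qed

lemma bounded_linear_star: "bounded_linear (star :: 'a \<Rightarrow> 'a::cstar_algebra_1)"
  by (rule bounded_linear_intro[where K = 1])
     (simp_all add: star_add scaleR_scaleC star_scaleC norm_star)

lemma star_1 [simp]: "star (1::'a::cstar_algebra_1) = 1"
  using star_mult[of "star (1::'a)" 1] by (simp add: star_star)

lemma star_0 [simp]: "star (0::'a::cstar_algebra_1) = 0"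
  by (rule linear_simps(3)[OF bounded_linear_star])

lemma star_diff: "star (x - y) = star x - star (y::'a::cstar_algebra_1)"
  by (rule linear_simps(2)[OF bounded_linear_star])

lemma star_scaleR: "star (r *\<^sub>R x) = r *\<^sub>R star (x::'a::cstar_algebra_1)"
  by (rule linear_simps(5)[OF bounded_linear_star])

lemma star_sum: "star (sum f A) = (\<Sum>i\<in>A. star (f i::'a::cstar_algebra_1))"
  by (rule bounded_linear.linear[OF bounded_linear_star, THEN linear_sum])

lemma star_power: "star (x ^ n) = star (x::'a::cstar_algebra_1) ^ n"
  by (induction n) (simp_all add: star_mult power_commutes)

lemma star_invsqrt:
  fixes y :: "'a::cstar_algebra_1"
  assumes "norm y < 1" "star y = y"
  shows "star (invsqrt y) = invsqrt y"
  unfolding invsqrt_def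
  using bounded_linear.suminf[OF bounded_linear_star summable_invsqrt[OF assms(1)]]
  by (simp add: star_scaleR star_power assms(2))

lemma unitariesD:
  assumes "U \<in> (unitaries :: 'a::cstar_algebra_1 set)"
  shows "star U * U = 1" "U * star U = 1"
  using assms by (auto simp: unitaries_def)

lemma unitaries_star: "U \<in> unitaries \<Longrightarrow> star U \<in> (unitaries :: 'a::cstar_algebra_1 set)"
  by (simp add: unitaries_def star_star)

lemma unitaries_mult:
  assumes "U \<in> unitaries" "V \<in> unitaries"
  shows "U * V \<in> (unitaries :: 'a::cstar_algebra_1 set)"
proof -
  have "star V * (star U * U) * V = 1" "U * (V * star V) * star U = 1"
    using assms by (simp_all add: unitariesD)
  then show ?thesis by (simp add: unitaries_def star_mult mult.assoc)
qed

lemma one_in_unitaries [simp]: "1 \<in> (unitaries :: 'a::cstar_algebra_1 set)"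
  by (simp add: unitaries_def)

text \<open>
  An open neighbourhood of the unitaries on which \<open>star x * x\<close> and \<open>x * star x\<close> are both invertible; the
  second condition excludes proper isometries.  The bound stays away from 1 so that the series for
  the inverse square root converges uniformly.
\<close>

definition almost_unitaries :: "'a::cstar_algebra_1 set" where
  "almost_unitaries = {x. norm (1 - star x * x) < 1 / 2 \<and> norm (1 - x * star x) < 1 / 2}"

text \<open>
  The unitary factor \<open>x \<bar>x\<bar>\<^sup>-\<^sup>1\<close> of the polar decomposition.
\<close>

definition unitary_part :: "'a::cstar_algebra_1 \<Rightarrow> 'a" where
  "unitary_part x = x * invsqrt (1 - star x * x)"

lemma unitaries_subset_almost: "unitaries \<subseteq> (almost_unitaries :: 'a::cstar_algebra_1 set)"
  by (auto simp: unitaries_def almost_unitaries_def)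

lemma open_almost_unitaries: "open (almost_unitaries :: 'a::cstar_algebra_1 set)"
  unfolding almost_unitaries_def
  by (intro open_Collect_conj open_Collect_less continuous_intros continuous_on_star)

lemma unitary_part_unitary: "U \<in> unitaries \<Longrightarrow> unitary_part U = (U::'a::cstar_algebra_1)"
  by (simp add: unitary_part_def unitariesD)

lemma continuous_on_unitary_part: "continuous_on (almost_unitaries :: 'a::cstar_algebra_1 set) unitary_part"
  unfolding unitary_part_def
  by (intro continuous_intros continuous_on_compose2[OF continuous_on_invsqrt[OF _ order_refl, of "1/2"]]
        continuous_on_star)
     (auto simp: almost_unitaries_def)

text \<open>
  With \<open>s = \<bar>x\<bar>\<^sup>-\<^sup>1\<close> the product \<open>star u * u = s * (star x * x) * s\<close> is 1 directly.  For the other order,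
  \<open>(x * star x) * (u * star u) = x * star x\<close>, and \<open>x * star x\<close> is close enough to 1 to be cancelled.
\<close>

lemma unitary_part_in_unitaries:
  fixes x :: "'a::cstar_algebra_1"
  assumes x: "x \<in> almost_unitaries"
  shows "unitary_part x \<in> unitaries"
proof -
  define y where "y = 1 - star x * x"
  define s where "s = invsqrt y"
  define u where "u = x * s"
  have y: "norm y < 1" and z: "norm (1 - x * star x) < 1" using x by (auto simp: almost_unitaries_def y_def)
  have "star y = y" by (simp add: y_def star_diff star_mult star_star)
  then have star_s: "star s = s" using star_invsqrt[OF y] by (simp add: s_def)
  have xx: "star x * x = 1 - y" by (simp add: y_def)
  have "s * (1 - y) = (1 - y) * s"
    using invsqrt_commute[OF y, of "1 - y"] by (simp add: s_def algebra_simps)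
  moreover have "s * s * (1 - y) = 1" using invsqrt_square[OF y] by (simp add: s_def)
  ultimately have sq: "s * (1 - y) * s = 1" "(1 - y) * s * s = 1" by (metis mult.assoc)+
  have "star u * u = s * (star x * x) * s" by (simp add: u_def star_mult star_s mult.assoc)
  then have 1: "star u * u = 1" using sq by (simp add: xx)
  have uu: "u * star u = x * (s * s) * star x" by (simp add: u_def star_mult star_s mult.assoc)
  have "(x * star x) * (u * star u) = x * ((1 - y) * s * s) * star x"
    by (simp add: uu xx[symmetric] mult.assoc)
  also have "(1 - y) * s * s = 1" by (rule sq)
  finally have "(x * star x) * (1 - u * star u) = 0" by (simp add: algebra_simps)
  then have "(1 - x * star x) * (1 - u * star u) = 1 - u * star u"
    by (simp only: left_diff_distrib[of 1] mult_1_left diff_0_right)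
  then have le: "norm (1 - u * star u) \<le> norm (1 - x * star x) * norm (1 - u * star u)"
    by (metis norm_mult_ineq)
  \<comment> \<open>the norm of \<open>1 - x * star x\<close> is less than 1\<close>
  have "1 - u * star u = 0"
  proof (rule ccontr)
    assume "1 - u * star u \<noteq> 0"
    then have "norm (1 - u * star u) > 0" by simp
    then have "norm (1 - x * star x) * norm (1 - u * star u) < 1 * norm (1 - u * star u)"
      using z by (intro mult_strict_right_mono)
    then show False using le by simp
  qed
  then have "u * star u = 1" by simp
  with 1 show ?thesis by (simp add: unitaries_def unitary_part_def u_def s_def y_def)
qed

text \<open>
  A loop whose values commute with the commutant of a matrix subalgebra keeps this property when it is
  corrected to a loop of unitaries.
\<close>

lemma unitary_part_commute:
  fixes x :: "'a::cstar_algebra_1"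
  assumes x: "x \<in> almost_unitaries" and b: "b * x = x * b" "b * star x = star x * b"
  shows "b * unitary_part x = unitary_part x * b"
proof -
  have "b * (star x * x) = (star x * x) * b" using b by (metis mult.assoc)
  then have "b * invsqrt (1 - star x * x) = invsqrt (1 - star x * x) * b"
    using x by (intro invsqrt_commute) (auto simp: almost_unitaries_def algebra_simps)
  then show ?thesis unfolding unitary_part_def using b by (metis mult.assoc)
qed

section \<open>Matrix subalgebras and their commutants\<close>

interpretation scaleC: vector_space "scaleC :: complex \<Rightarrow> 'a \<Rightarrow> 'a::cstar_algebra_1"
  by (rule vector_space_scaleC)

definition matrix_units :: "nat \<Rightarrow> (nat \<Rightarrow> nat \<Rightarrow> 'a::cstar_algebra_1) \<Rightarrow> bool" where
  "matrix_units n e \<longleftrightarrow>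
     (\<forall>a<n. \<forall>b<n. \<forall>c<n. \<forall>d<n. e a b * e c d = (if b = c then e a d else 0)) \<and>
     (\<forall>a<n. \<forall>b<n. star (e a b) = e b a) \<and>
     (\<Sum>a<n. e a a) = 1"

text \<open>
  A unital copy of the algebra of \<open>n \<times> n\<close> matrices.  Instead of saying that the matrix units span
  \<open>S\<close>, the locale says that compressing an element of \<open>S\<close> to one position leaves a multiple of the matrix
  unit there; as the diagonal units sum to 1, this amounts to the same and gives direct
  access to the matrix entries.
\<close>

locale matrix_subalgebra =
  fixes S :: "'a::cstar_algebra_1 set" and n :: nat and e :: "nat \<Rightarrow> nat \<Rightarrow> 'a"
  assumes add_closed: "x \<in> S \<Longrightarrow> y \<in> S \<Longrightarrow> x + y \<in> S"
    and mult_closed: "x \<in> S \<Longrightarrow> y \<in> S \<Longrightarrow> x * y \<in> S"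
    and scaleC_closed: "x \<in> S \<Longrightarrow> c *\<^sub>C x \<in> S"
    and star_closed: "x \<in> S \<Longrightarrow> star x \<in> S"
    and units: "matrix_units n e"
    and units_closed: "a < n \<Longrightarrow> b < n \<Longrightarrow> e a b \<in> S"
    and entry_diag: "x \<in> S \<Longrightarrow> a < n \<Longrightarrow> b < n \<Longrightarrow> \<exists>c. e a a * x * e b b = c *\<^sub>C e a b"
begin

lemma unit_mult: "a < n \<Longrightarrow> b < n \<Longrightarrow> c < n \<Longrightarrow> d < n \<Longrightarrow> e a b * e c d = (if b = c then e a d else 0)"
  and unit_star: "a < n \<Longrightarrow> b < n \<Longrightarrow> star (e a b) = e b a"
  and unit_sum: "(\<Sum>a<n. e a a) = 1"
  using units by (auto simp: matrix_units_def)

lemma size_pos: "0 < n"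
  using unit_sum by (cases n) auto

lemma unit_nonzero:
  assumes "a < n" "b < n"
  shows "e a b \<noteq> 0"
proof
  assume z: "e a b = 0"
  have "e c c = 0" if "c < n" for c
  proof -
    have "e c c = e c a * e a b * e b c" using that assms by (simp add: unit_mult)
    then show ?thesis using z by simp
  qed
  then show False using unit_sum by simp
qed

lemma zero_closed: "0 \<in> S"
  using scaleC_closed[OF units_closed, of 0 0 0] size_pos by simp

lemma sum_closed: "(\<And>i. i \<in> I \<Longrightarrow> f i \<in> S) \<Longrightarrow> sum f I \<in> S"
  by (induction I rule: infinite_finite_induct) (auto intro: add_closed zero_closed)

lemma diff_closed:
  assumes "x \<in> S" "y \<in> S"
  shows "x - y \<in> S"
  using add_closed[OF assms(1) scaleC_closed[OF assms(2), of "-1"]] by simp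

lemma entry:
  assumes x: "x \<in> S" and ab: "a < n" "b < n" "a' < n" "b' < n"
  obtains c where "e a' a * x * e b b' = c *\<^sub>C e a' b'"
proof -
  obtain c where c: "e a a * x * e b b = c *\<^sub>C e a b" using entry_diag[OF x] ab by blast
  have "e a' a * x * e b b' = e a' a * (e a a * x * e b b) * e b b'"
    using ab by (simp add: mult.assoc unit_mult) (simp add: mult.assoc[symmetric] unit_mult)
  also have "\<dots> = c *\<^sub>C e a' b'"
    using ab by (simp add: c mult_scaleC_left mult_scaleC_right unit_mult)
  finally show thesis by (rule that)
qed

lemma commute_units_imp_commute:
  assumes y: "\<And>a b. a < n \<Longrightarrow> b < n \<Longrightarrow> y * e a b = e a b * y" and x: "x \<in> S"
  shows "y * x = x * y"
proof -
  have expand: "x = (\<Sum>a<n. \<Sum>b<n. e a a * x * e b b)"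
  proof -
    have "x = (\<Sum>a<n. e a a) * x * (\<Sum>b<n. e b b)" by (simp add: unit_sum)
    then show ?thesis by (simp only: sum_distrib_right[of _ _ x] sum_product)
  qed
  have "y * (e a a * x * e b b) = e a a * x * e b b * y" if "a < n" "b < n" for a b
    using entry_diag[OF x that] y[OF that] by (auto simp: mult_scaleC_left mult_scaleC_right)
  then show ?thesis
    by (subst (1 2) expand) (simp add: sum_distrib_left sum_distrib_right)
qed

text \<open>
  An element with \<open>v * e 0 0 = v\<close> is a column vector, and \<open>star v * v\<close> is the sum of the squared moduli
  of its entries.  This replaces the general positivity theorem for \<open>star v * v\<close> in a C*-algebra.
\<close>

lemma column_norm:
  assumes v: "v \<in> S" "v * e 0 0 = v"
  obtains l where "l \<ge> 0" "star v * v = complex_of_real l *\<^sub>C e 0 0"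
proof -
  have "\<exists>c. e a a * v = c *\<^sub>C e a 0" if "a < n" for a
    using entry_diag[OF v(1) that size_pos] v(2) by (simp add: mult.assoc)
  then obtain \<mu> where \<mu>: "\<And>a. a < n \<Longrightarrow> e a a * v = \<mu> a *\<^sub>C e a 0" by metis
  have summand: "star v * e a a * v = complex_of_real ((cmod (\<mu> a))\<^sup>2) *\<^sub>C e 0 0" if a: "a < n" for a
  proof -
    have "star v * e a a * v = star (e a a * v) * (e a a * v)"
      using a by (simp add: star_mult unit_star mult.assoc) (simp add: mult.assoc[symmetric] unit_mult)
    also have "\<dots> = (cnj (\<mu> a) * \<mu> a) *\<^sub>C e 0 0"
      using a size_pos by (simp add: \<mu> star_scaleC unit_star mult_scaleC_left mult_scaleC_right unit_mult)
    finally show ?thesis by (simp only: complex_norm_square mult.commute)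
  qed
  have "star v * v = star v * (\<Sum>a<n. e a a) * v" by (simp add: unit_sum)
  also have "\<dots> = (\<Sum>a<n. star v * e a a * v)" by (simp only: sum_distrib_left sum_distrib_right)
  also have "\<dots> = (\<Sum>a<n. complex_of_real ((cmod (\<mu> a))\<^sup>2) *\<^sub>C e 0 0)" by (intro sum.cong) (auto simp: summand)
  also have "\<dots> = complex_of_real (\<Sum>a<n. (cmod (\<mu> a))\<^sup>2) *\<^sub>C e 0 0"
    by (simp only: scaleC.scale_sum_left of_real_sum)
  finally show thesis by (intro that[of "\<Sum>a<n. (cmod (\<mu> a))\<^sup>2"] sum_nonneg) auto
qed

text \<open>
  An orthonormal basis \<open>w\<close> of the range of \<open>q\<close>, written as column vectors, obtained by applying the
  Gram--Schmidt process to the columns \<open>q * e c 0\<close> of \<open>q\<close>.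
\<close>

lemma projection_decomposition:
  assumes q: "q \<in> S" "star q = q" "q * q = q"
  shows "\<exists>(r::nat) w. (\<forall>a<r. w a \<in> S \<and> q * w a = w a \<and> w a * e 0 0 = w a) \<and>
    (\<forall>a<r. \<forall>b<r. star (w a) * w b = (if a = b then e 0 0 else 0)) \<and>
    (\<Sum>a<r. w a * star (w a)) = q"
proof -
  define good where "good r w \<longleftrightarrow> (\<forall>a<r. w a \<in> S \<and> q * w a = w a \<and> w a * e 0 0 = w a) \<and>
    (\<forall>a<r. \<forall>b<r. star (w a) * w b = (if a = b then e 0 0 else 0))" for r :: nat and w
  \<comment> \<open>after step \<open>k\<close> the first \<open>k\<close> columns of \<open>q\<close> lie in the span of the vectors chosen so far\<close>
  have "\<exists>r w. good r w \<and> (\<forall>c<k. (q - (\<Sum>a<r. w a * star (w a))) * e c 0 = 0)" if "k \<le> n" for k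
    using that
  proof (induction k)
    case 0
    show ?case by (rule exI[of _ 0]) (simp add: good_def)
  next
    case (Suc k)
    then obtain r w where good: "good r w" and kill: "\<forall>c<k. (q - (\<Sum>a<r. w a * star (w a))) * e c 0 = 0"
      by auto
    \<comment> \<open>\<open>p\<close> projects onto the part of the range of \<open>q\<close> not yet exhausted, and \<open>v\<close> is the next column\<close>
    define p where "p = q - (\<Sum>a<r. w a * star (w a))"
    define v where "v = p * e k 0"
    have w: "w a \<in> S" "q * w a = w a" "w a * e 0 0 = w a" if "a < r" for a
      using good that by (auto simp: good_def)
    have ww: "star (w a) * w b = (if a = b then e 0 0 else 0)" if "a < r" "b < r" for a b
      using good that by (auto simp: good_def)
    have k: "k < n" using Suc by simp
    have w0: "e 0 0 * star (w a) = star (w a)" if "a < r" for a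
      using w(3)[OF that] unit_star[of 0 0] size_pos by (metis star_mult)
    have wp: "star (w a) * p = 0" if a: "a < r" for a
    proof -
      have "star (w a) * (\<Sum>b<r. w b * star (w b)) = (\<Sum>b<r. if b = a then star (w a) else 0)"
        unfolding sum_distrib_left mult.assoc[symmetric] by (intro sum.cong) (auto simp: ww a w0)
      then have "star (w a) * (\<Sum>b<r. w b * star (w b)) = star (w a)" using a by simp
      moreover have "star (w a) * q = star (w a)" using w(2)[OF a] q(2) by (metis star_mult)
      ultimately show ?thesis by (simp add: p_def right_diff_distrib)
    qed
    have p_star: "star p = p" by (simp add: p_def star_diff q(2) star_sum star_mult star_star)
    have qp: "q * p = p"
      by (simp add: p_def right_diff_distrib q(3) sum_distrib_left mult.assoc[symmetric] w(2))
    have pp: "p * p = p"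
    proof -
      have "p * p = q * p - (\<Sum>a<r. w a * (star (w a) * p))"
        by (subst (1) p_def) (simp add: left_diff_distrib sum_distrib_right mult.assoc)
      then show ?thesis by (simp add: wp qp)
    qed
    have pS: "p \<in> S" unfolding p_def
      by (intro diff_closed sum_closed mult_closed star_closed q(1)) (auto simp: w)
    have vS: "v \<in> S" unfolding v_def using k size_pos by (intro mult_closed pS units_closed)
    have v0: "v * e 0 0 = v" using k size_pos by (simp add: v_def mult.assoc unit_mult)
    have qv: "q * v = v" by (simp add: v_def mult.assoc[symmetric] qp)
    have wv: "star (w a) * v = 0" if "a < r" for a
      using wp[OF that] by (simp add: v_def mult.assoc[symmetric])
    have sv: "star v = e 0 k * p" using k size_pos by (simp add: v_def star_mult p_star unit_star)
    have "star v * v = e 0 k * (p * p) * e k 0" unfolding sv by (simp add: v_def mult.assoc)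
    then have vv': "star v * v = e 0 k * p * e k 0" by (simp only: pp)
    obtain l where l: "l \<ge> 0" "star v * v = complex_of_real l *\<^sub>C e 0 0" using column_norm[OF vS v0] .
    show ?case
    proof (cases "v = 0")
      case True
      then have "\<forall>c<Suc k. (q - (\<Sum>a<r. w a * star (w a))) * e c 0 = 0"
        using kill by (auto simp: less_Suc_eq v_def p_def)
      then show ?thesis using good by blast
    next
      case False
      have "l \<noteq> 0"
      proof
        assume "l = 0"
        then have "norm (star v * v) = 0" using l by simp
        then show False using False by (simp add: norm_star_mult_self)
      qed
      then have "l > 0" using l by simp
      define u where "u = complex_of_real (1 / sqrt l) *\<^sub>C v"
      have "(1 / sqrt l) * (1 / sqrt l) = 1 / l" using \<open>l > 0\<close> by simp
      then have inv: "complex_of_real (1 / sqrt l) * complex_of_real (1 / sqrt l) = complex_of_real (1 / l)"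
        by (metis of_real_mult)
      have uu: "star u * u = e 0 0"
      proof -
        have "star u * u = complex_of_real (1 / l) *\<^sub>C (star v * v)"
          unfolding u_def star_scaleC mult_scaleC_left mult_scaleC_right scaleC_scaleC
          by (simp only: complex_cnj_complex_of_real inv)
        then show ?thesis using \<open>l > 0\<close> l(2)
          by (simp add: scaleC_scaleC of_real_mult[symmetric] del: of_real_mult)
      qed
      have uu': "u * star u = complex_of_real (1 / l) *\<^sub>C (v * star v)"
        unfolding u_def star_scaleC mult_scaleC_left mult_scaleC_right scaleC_scaleC
        by (simp only: complex_cnj_complex_of_real inv)
      define w' where "w' = w(r := u)"
      have sum': "(\<Sum>a<Suc r. w' a * star (w' a)) = (\<Sum>a<r. w a * star (w a)) + u * star u"
        by (simp add: w'_def)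
      have uw: "star u * w a = 0" "star (w a) * u = 0" if "a < r" for a
      proof -
        show *: "star (w a) * u = 0" using wv[OF that] by (simp add: u_def mult_scaleC_right)
        show "star u * w a = 0" using arg_cong[OF *, of star] by (simp add: star_mult star_star)
      qed
      have uS: "u \<in> S" "q * u = u" "u * e 0 0 = u"
        using vS qv v0 by (simp_all add: u_def scaleC_closed mult_scaleC_left mult_scaleC_right)
      have "good (Suc r) w'"
        unfolding good_def w'_def using w ww uw uu uS by (auto simp: less_Suc_eq)
      moreover have "(q - (\<Sum>a<Suc r. w' a * star (w' a))) * e c 0 = 0" if c: "c < Suc k" for c
      proof (cases "c = k")
        case True
        have "u * star u * e k 0 = complex_of_real (1 / l) *\<^sub>C (v * (e 0 k * p * e k 0))"
          by (simp add: uu' sv mult_scaleC_left mult.assoc)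
        also have "\<dots> = v"
          using \<open>l > 0\<close> unfolding vv'[symmetric] l(2)
          by (simp add: mult_scaleC_right scaleC_scaleC v0 of_real_mult[symmetric] del: of_real_mult)
        finally show ?thesis
          unfolding sum' using True by (simp add: diff_diff_eq[symmetric] p_def[symmetric] left_diff_distrib v_def)
      next
        case False
        then have pc: "p * e c 0 = 0" using kill c by (auto simp: p_def)
        then have "u * star u * e c 0 = 0" by (simp add: uu' sv mult_scaleC_left mult.assoc)
        then show ?thesis
          unfolding sum' using pc by (simp add: diff_diff_eq[symmetric] p_def[symmetric] left_diff_distrib)
      qed
      ultimately show ?thesis by blast
    qed
  qed
  then obtain r w where good: "good r w"
    and kill: "\<And>c. c < n \<Longrightarrow> (q - (\<Sum>a<r. w a * star (w a))) * e c 0 = 0" by blast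
  have "q - (\<Sum>a<r. w a * star (w a)) = (q - (\<Sum>a<r. w a * star (w a))) * (\<Sum>c<n. e c 0 * e 0 c)"
    using size_pos by (simp add: unit_mult unit_sum)
  also have "\<dots> = (\<Sum>c<n. (q - (\<Sum>a<r. w a * star (w a))) * e c 0 * e 0 c)"
    unfolding sum_distrib_left by (simp add: mult.assoc)
  also have "\<dots> = 0" by (simp add: kill)
  finally have sum: "(\<Sum>a<r. w a * star (w a)) = q" by simp
  show ?thesis using good sum unfolding good_def by blast
qed

text \<open>
  The matrix unit \<open>e 0 0\<close> multiplied by the trace of \<open>x\<close>, kept inside the algebra so that no scalars have to be extracted.
\<close>

definition trace_at_corner :: "'a \<Rightarrow> 'a" where
  "trace_at_corner x = (\<Sum>c<n. e 0 c * x * e c 0)"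

lemma trace_sum: "trace_at_corner (sum f I) = (\<Sum>i\<in>I. trace_at_corner (f i))"
  unfolding trace_at_corner_def sum_distrib_left sum_distrib_right by (rule sum.swap)

lemma trace_1: "trace_at_corner 1 = of_nat n * e 0 0"
  unfolding trace_at_corner_def using size_pos by (simp add: unit_mult)

lemma trace_corner_unit: "trace_at_corner (e 0 0) = e 0 0"
proof -
  have "trace_at_corner (e 0 0) = (\<Sum>c<n. if c = 0 then e 0 0 else 0)"
    unfolding trace_at_corner_def using size_pos by (intro sum.cong) (auto simp: unit_mult)
  then show ?thesis using size_pos by simp
qed

lemma trace_commute:
  assumes x: "x \<in> S" and y: "y \<in> S"
  shows "trace_at_corner (x * y) = trace_at_corner (y * x)"
proof -
  have split: "trace_at_corner (z * z') = (\<Sum>c<n. \<Sum>d<n. (e 0 c * z * e d 0) * (e 0 d * z' * e c 0))" for z z'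
  proof -
    have "e 0 c * (z * z') * e c 0 = (\<Sum>d<n. (e 0 c * z * e d 0) * (e 0 d * z' * e c 0))" for c
    proof -
      have "e 0 c * (z * z') * e c 0 = e 0 c * z * (\<Sum>d<n. e d 0 * e 0 d) * z' * e c 0"
        using size_pos by (simp add: unit_mult unit_sum mult.assoc)
      then show ?thesis by (simp add: sum_distrib_left sum_distrib_right mult.assoc)
    qed
    then show ?thesis by (simp add: trace_at_corner_def)
  qed
  have comm: "(e 0 c * x * e d 0) * (e 0 d * y * e c 0) = (e 0 d * y * e c 0) * (e 0 c * x * e d 0)"
    if cd: "c < n" "d < n" for c d
  proof -
    obtain s where s: "e 0 c * x * e d 0 = s *\<^sub>C e 0 0" using entry[OF x cd size_pos size_pos] .
    obtain t where t: "e 0 d * y * e c 0 = t *\<^sub>C e 0 0" using entry[OF y cd(2,1) size_pos size_pos] .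
    show ?thesis unfolding s t by (simp add: mult_scaleC_left mult_scaleC_right scaleC_scaleC mult.commute)
  qed
  have "trace_at_corner (x * y) = (\<Sum>c<n. \<Sum>d<n. (e 0 d * y * e c 0) * (e 0 c * x * e d 0))"
    unfolding split by (intro sum.cong) (auto simp: comm)
  also have "\<dots> = trace_at_corner (y * x)" unfolding split by (rule sum.swap)
  finally show ?thesis .
qed

end

text \<open>
  The matrix algebra \<open>T\<close> is the tensor product of its unital subalgebra \<open>S\<close> and the commutant of \<open>S\<close> in
  \<open>T\<close>, which is an algebra of \<open>r \<times> r\<close> matrices.  An
  orthonormal basis \<open>w\<close> of the range of \<open>e 0 0\<close> gives the matrix units \<open>w a * star (w b)\<close> of the corner at
  \<open>e 0 0\<close>, and copying them along the diagonal by means of \<open>e i 0\<close> makes them commute with all \<open>e i j\<close>.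
  Comparing traces yields \<open>m = r * n\<close>.
\<close>

theorem commutant_matrix_units:
  assumes "matrix_subalgebra S n e" and "matrix_subalgebra T m E" and ST: "S \<subseteq> T"
  obtains r f where "matrix_units r f" "m = r * n"
    "\<forall>a<r. \<forall>b<r. \<forall>x\<in>S. f a b * x = x * f a b"
proof -
  interpret S: matrix_subalgebra S n e by fact
  interpret T: matrix_subalgebra T m E by fact
  note n0 = S.size_pos
  have eT: "e i j \<in> T" if "i < n" "j < n" for i j using S.units_closed[OF that] ST by blast
  have e00: "e 0 0 * e 0 0 = e 0 0" using n0 by (simp add: S.unit_mult)
  obtain r :: nat and w
    where rw: "\<forall>a<r. w a \<in> T \<and> e 0 0 * w a = w a \<and> w a * E 0 0 = w a"
      "\<forall>a<r. \<forall>b<r. star (w a) * w b = (if a = b then E 0 0 else 0)"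
      and ws: "(\<Sum>a<r. w a * star (w a)) = e 0 0"
    using T.projection_decomposition[OF eT[OF n0 n0] S.unit_star[OF n0 n0] e00] by blast
  have w: "w a \<in> T" "e 0 0 * w a = w a" "w a * E 0 0 = w a" if "a < r" for a
    using rw(1) that by blast+
  have ww: "star (w a) * w b = (if a = b then E 0 0 else 0)" if "a < r" "b < r" for a b
    using rw(2) that by blast
  have w': "star (w a) * e 0 0 = star (w a)" if "a < r" for a
    using w(2)[OF that] S.unit_star[OF n0 n0] by (metis star_mult)
  define f where "f a b = (\<Sum>i<n. e i 0 * w a * star (w b) * e 0 i)" for a b
  have f_mult: "f a b * f c d = (if b = c then f a d else 0)" if abcd: "a < r" "b < r" "c < r" "d < r" for a b c d
  proof -
    have "e i 0 * w a * star (w b) * e 0 i * (e j 0 * w c * star (w d) * e 0 j)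
        = (if i = j \<and> b = c then e i 0 * w a * star (w d) * e 0 i else 0)" if ij: "i < n" "j < n" for i j
    proof -
      have "e i 0 * w a * star (w b) * e 0 i * (e j 0 * w c * star (w d) * e 0 j)
          = e i 0 * w a * star (w b) * (e 0 i * e j 0) * w c * star (w d) * e 0 j"
        by (simp add: mult.assoc)
      also have "\<dots> = (if i = j then e i 0 * w a * star (w b) * (e 0 0 * w c) * star (w d) * e 0 i else 0)"
        using ij n0 by (auto simp: S.unit_mult mult.assoc)
      also have "\<dots> = (if i = j then e i 0 * w a * (star (w b) * w c) * star (w d) * e 0 i else 0)"
        using abcd by (simp add: w mult.assoc)
      also have "\<dots> = (if i = j \<and> b = c then e i 0 * (w a * E 0 0) * star (w d) * e 0 i else 0)"
        using abcd by (simp add: ww mult.assoc)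
      finally show ?thesis using abcd by (simp add: w)
    qed
    then have "f a b * f c d = (\<Sum>i<n. \<Sum>j<n. if i = j \<and> b = c then e i 0 * w a * star (w d) * e 0 i else 0)"
      unfolding f_def sum_product by (intro sum.cong) auto
    also have "\<dots> = (\<Sum>i<n. if b = c then e i 0 * w a * star (w d) * e 0 i else 0)"
      by (intro sum.cong refl) (auto simp: sum.delta)
    finally show ?thesis by (simp add: f_def)
  qed
  have f_star: "star (f a b) = f b a" if "a < r" "b < r" for a b
    using n0 by (simp add: f_def star_sum star_mult star_star S.unit_star mult.assoc)
  have f_sum: "(\<Sum>a<r. f a a) = 1"
  proof -
    have "(\<Sum>a<r. f a a) = (\<Sum>i<n. \<Sum>a<r. e i 0 * (w a * star (w a)) * e 0 i)"
      unfolding f_def by (subst sum.swap) (simp add: mult.assoc)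
    also have "\<dots> = (\<Sum>i<n. e i 0 * (\<Sum>a<r. w a * star (w a)) * e 0 i)"
      by (simp add: sum_distrib_left sum_distrib_right)
    also have "\<dots> = (\<Sum>i<n. e i i)" using n0 by (simp add: ws S.unit_mult)
    finally show ?thesis by (simp add: S.unit_sum)
  qed
  have units: "matrix_units r f" using f_mult f_star f_sum by (simp add: matrix_units_def)
  have f_commute: "f a b * e i j = e i j * f a b" if "i < n" "j < n" for a b i j
  proof -
    have "f a b * e i j = (\<Sum>k<n. if k = i then e i 0 * w a * star (w b) * e 0 j else 0)"
      unfolding f_def sum_distrib_right using that n0 by (intro sum.cong) (auto simp: mult.assoc S.unit_mult)
    also have "\<dots> = e i 0 * w a * star (w b) * e 0 j" using that by (simp add: sum.delta)
    also have "\<dots> = (\<Sum>k<n. if k = j then e i 0 * w a * star (w b) * e 0 j else 0)"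
      using that by (simp add: sum.delta)
    also have "\<dots> = e i j * f a b"
      unfolding f_def sum_distrib_left using that n0
      by (intro sum.cong) (auto simp: mult.assoc[symmetric] S.unit_mult)
    finally show ?thesis .
  qed
  \<comment> \<open>the unit is the sum of the \<open>r * n\<close> rank one projections onto the vectors \<open>e i 0 * w a\<close>\<close>
  have "m = r * n"
  proof -
    have "of_nat m * E 0 0 = T.trace_at_corner (\<Sum>a<r. f a a)" by (simp add: f_sum T.trace_1)
    also have "\<dots> = (\<Sum>a<r. \<Sum>i<n. T.trace_at_corner ((e i 0 * w a) * (star (w a) * e 0 i)))"
      by (simp add: f_def T.trace_sum mult.assoc)
    also have "\<dots> = (\<Sum>a<r. \<Sum>i<n. T.trace_at_corner ((star (w a) * e 0 i) * (e i 0 * w a)))"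
      using n0 by (intro sum.cong refl T.trace_commute T.mult_closed T.star_closed eT w(1)) auto
    also have "\<dots> = (\<Sum>a<r. \<Sum>i<n. E 0 0)"
    proof (intro sum.cong refl)
      fix a i assume ai: "a \<in> {..<r}" "i \<in> {..<n}"
      have "(star (w a) * e 0 i) * (e i 0 * w a) = star (w a) * (e 0 i * e i 0) * w a"
        by (simp add: mult.assoc)
      also have "\<dots> = E 0 0" using ai n0 by (simp add: S.unit_mult w' ww)
      finally show "T.trace_at_corner ((star (w a) * e 0 i) * (e i 0 * w a)) = E 0 0"
        by (simp add: T.trace_corner_unit)
    qed
    also have "\<dots> = of_nat (r * n) * E 0 0" by (simp add: mult.assoc)
    finally have "(of_nat m - of_nat (r * n)) * E 0 0 = 0" by (simp add: algebra_simps)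
    then have "(real m - real (r * n)) *\<^sub>R E 0 0 = 0"
      by (simp add: scaleR_conv_of_real)
    then have "real m = real (r * n)" using T.unit_nonzero[OF T.size_pos T.size_pos] by simp
    then show ?thesis by (simp only: of_nat_eq_iff)
  qed
  moreover have "\<forall>a<r. \<forall>b<r. \<forall>x\<in>S. f a b * x = x * f a b"
    using S.commute_units_imp_commute[OF f_commute] by blast
  ultimately show thesis using that units by blast
qed

section \<open>UHF algebras as unions of matrix subalgebras\<close>

definition matrix_unit :: "nat \<Rightarrow> nat \<Rightarrow> nat \<Rightarrow> complex mat" where
  "matrix_unit n a b = mat n n (\<lambda>r. if r = (a, b) then 1 else 0)"

lemma matrix_unit_carrier [simp]: "matrix_unit n a b \<in> cmats n"
  by (simp add: matrix_unit_def)

lemma matrix_unit_mult_left: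
  assumes "X \<in> cmats n" "b < n"
  shows "matrix_unit n a b * X = mat n n (\<lambda>(i, j). if i = a then X $$ (b, j) else 0)"
proof (rule eq_matI, goal_cases)
  case (1 i j)
  have "(matrix_unit n a b * X) $$ (i, j) = (\<Sum>k<n. (if i = a \<and> k = b then 1 else 0) * X $$ (k, j))"
    using 1 assms by (simp add: matrix_unit_def scalar_prod_def lessThan_atLeast0 cong: if_cong)
  also have "\<dots> = (\<Sum>k<n. if k = b then (if i = a then X $$ (b, j) else 0) else 0)"
    by (intro sum.cong) auto
  also have "\<dots> = (if i = a then X $$ (b, j) else 0)" using assms by (simp add: sum.delta)
  finally show ?case using 1 by simp
qed (use assms in \<open>auto simp: matrix_unit_def\<close>)

lemma matrix_unit_mult_right:
  assumes "X \<in> cmats n" "c < n"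
  shows "X * matrix_unit n c d = mat n n (\<lambda>(i, j). if j = d then X $$ (i, c) else 0)"
proof (rule eq_matI, goal_cases)
  case (1 i j)
  have "(X * matrix_unit n c d) $$ (i, j) = (\<Sum>k<n. X $$ (i, k) * (if k = c \<and> j = d then 1 else 0))"
    using 1 assms by (simp add: matrix_unit_def scalar_prod_def lessThan_atLeast0 cong: if_cong)
  also have "\<dots> = (\<Sum>k<n. if k = c then (if j = d then X $$ (i, c) else 0) else 0)"
    by (intro sum.cong) auto
  also have "\<dots> = (if j = d then X $$ (i, c) else 0)" using assms by (simp add: sum.delta)
  finally show ?case using 1 by simp
qed (use assms in \<open>auto simp: matrix_unit_def\<close>)

lemma matrix_unit_mult:
  assumes "b < n" "c < n"
  shows "matrix_unit n a b * matrix_unit n c d = (if b = c then matrix_unit n a d else 0\<^sub>m n n)"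
  using assms by (subst matrix_unit_mult_left) (auto simp: matrix_unit_def intro!: eq_matI)

lemma matrix_unit_adjoint: "mat_adjoint (matrix_unit n a b) = matrix_unit n b a"
  by (rule eq_matI) (auto simp: mat_adjoint_def matrix_unit_def mat_of_rows_def conjugate_complex_def)

lemma matrix_unit_compress:
  assumes "X \<in> cmats n" "a < n" "b < n"
  shows "matrix_unit n a a * X * matrix_unit n b b = X $$ (a, b) \<cdot>\<^sub>m matrix_unit n a b"
  using assms
  by (simp add: matrix_unit_mult_left matrix_unit_mult_right) (auto simp: matrix_unit_def intro!: eq_matI)

lemma matrix_subalgebra_image:
  fixes \<iota> :: "complex mat \<Rightarrow> 'a::cstar_algebra_1"
  assumes i: "mat_alg_unital_star_hom n \<iota>"
  shows "matrix_subalgebra (\<iota> ` cmats n) n (\<lambda>a b. \<iota> (matrix_unit n a b))"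
proof -
  have one: "\<iota> (1\<^sub>m n) = 1"
    and add: "\<And>X Y. X \<in> cmats n \<Longrightarrow> Y \<in> cmats n \<Longrightarrow> \<iota> (X + Y) = \<iota> X + \<iota> Y"
    and scale: "\<And>c X. X \<in> cmats n \<Longrightarrow> \<iota> (c \<cdot>\<^sub>m X) = c *\<^sub>C \<iota> X"
    and mult: "\<And>X Y. X \<in> cmats n \<Longrightarrow> Y \<in> cmats n \<Longrightarrow> \<iota> (X * Y) = \<iota> X * \<iota> Y"
    and adj: "\<And>X. X \<in> cmats n \<Longrightarrow> \<iota> (mat_adjoint X) = star (\<iota> X)"
    using i by (auto simp: mat_alg_unital_star_hom_def)
  have adj_closed: "mat_adjoint X \<in> cmats n" if "X \<in> cmats n" for X
    using that by (auto simp: mat_adjoint_def)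
  have zero: "\<iota> (0\<^sub>m n n) = 0" using add[of "0\<^sub>m n n" "0\<^sub>m n n"] by simp
  have partial: "(\<Sum>a<k. \<iota> (matrix_unit n a a)) = \<iota> (mat n n (\<lambda>(i, j). if i = j \<and> i < k then 1 else 0))"
    if "k \<le> n" for k
    using that
  proof (induction k)
    case 0
    have "mat n n (\<lambda>(i, j). if i = j \<and> i < 0 then 1 else 0) = (0\<^sub>m n n :: complex mat)"
      by (rule eq_matI) auto
    then show ?case by (simp only: lessThan_0 sum.empty zero)
  next
    case (Suc k)
    have "mat n n (\<lambda>(i, j). if i = j \<and> i < Suc k then 1 else 0)
        = mat n n (\<lambda>(i, j). if i = j \<and> i < k then 1 else 0) + matrix_unit n k k"
      by (rule eq_matI) (auto simp: matrix_unit_def)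
    then show ?case using Suc by (simp add: add)
  qed
  have "mat n n (\<lambda>(i, j). if i = j \<and> i < n then 1 else 0) = (1\<^sub>m n :: complex mat)"
    by (rule eq_matI) auto
  then have unit_sum: "(\<Sum>a<n. \<iota> (matrix_unit n a a)) = 1" using partial[of n] by (simp add: one)
  have unit_mult: "\<iota> (matrix_unit n a b) * \<iota> (matrix_unit n c d) = (if b = c then \<iota> (matrix_unit n a d) else 0)"
    if "b < n" "c < n" for a b c d
    by (subst mult[symmetric]) (simp_all add: matrix_unit_mult zero that)
  have unit_star: "star (\<iota> (matrix_unit n a b)) = \<iota> (matrix_unit n b a)" for a b
    using adj[of "matrix_unit n a b"] by (simp add: matrix_unit_adjoint)
  have "matrix_units n (\<lambda>a b. \<iota> (matrix_unit n a b))"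
    unfolding matrix_units_def by (intro conjI allI impI unit_mult unit_star unit_sum)
  moreover have "\<exists>c. \<iota> (matrix_unit n a a) * x * \<iota> (matrix_unit n b b) = c *\<^sub>C \<iota> (matrix_unit n a b)"
    if x: "x \<in> \<iota> ` cmats n" and ab: "a < n" "b < n" for x a b
  proof -
    obtain X where X: "x = \<iota> X" "X \<in> cmats n" using x by (rule imageE)
    have "\<iota> (matrix_unit n a a) * x * \<iota> (matrix_unit n b b) = \<iota> (matrix_unit n a a * X * matrix_unit n b b)"
      using X mult_carrier_mat[OF matrix_unit_carrier X(2)] by (simp add: mult)
    also have "\<dots> = X $$ (a, b) *\<^sub>C \<iota> (matrix_unit n a b)"
      by (simp only: matrix_unit_compress[OF X(2) ab] scale matrix_unit_carrier)
    finally show ?thesis by (rule exI)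
  qed
  moreover have "x + y \<in> \<iota> ` cmats n \<and> x * y \<in> \<iota> ` cmats n" if xy: "x \<in> \<iota> ` cmats n" "y \<in> \<iota> ` cmats n" for x y
  proof -
    obtain X Y where "X \<in> cmats n" "x = \<iota> X" "Y \<in> cmats n" "y = \<iota> Y" using xy by blast
    then show ?thesis using add[of X Y] mult[of X Y] by (metis add_carrier_mat imageI mult_carrier_mat)
  qed
  moreover have "c *\<^sub>C x \<in> \<iota> ` cmats n \<and> star x \<in> \<iota> ` cmats n" if x: "x \<in> \<iota> ` cmats n" for c x
  proof -
    obtain X where "X \<in> cmats n" "x = \<iota> X" using x by blast
    then show ?thesis using scale[of X c] adj[of X] by (metis adj_closed imageI smult_carrier_mat)
  qed
  ultimately show ?thesis unfolding matrix_subalgebra_def by (simp only: imageI matrix_unit_carrier) blast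
qed

text \<open>
  The compatibility of the cocone with the connecting maps turns the matrix system into an increasing
  chain inside the algebra.
\<close>

lemma UHF_algebra_matrix_subalgebras:
  assumes "UHF_algebra TYPE('a::cstar_algebra_1)"
  obtains S :: "nat \<Rightarrow> 'a::cstar_algebra_1 set" and n e where
    "\<forall>j. matrix_subalgebra (S j) (n j) (e j)" "incseq S" "closure (\<Union>j. S j) = UNIV"
    "filterlim n at_top sequentially"
proof -
  obtain n \<phi> and \<iota> :: "nat \<Rightarrow> complex mat \<Rightarrow> 'a" where n: "filterlim n at_top sequentially"
    and sys: "matrix_system n \<phi>" and colim: "matrix_colimit n \<phi> \<iota>"
    using assms unfolding UHF_algebra_def by blast
  have "\<iota> j ` cmats (n j) \<subseteq> \<iota> (Suc j) ` cmats (n (Suc j))" for j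
  proof
    fix x assume "x \<in> \<iota> j ` cmats (n j)"
    then obtain X where X: "X \<in> cmats (n j)" "x = \<iota> j X" by blast
    have "\<phi> j X \<in> cmats (n (Suc j))" "\<iota> (Suc j) (\<phi> j X) = x"
      using X sys colim
      by (auto simp: matrix_system_def mat_unital_star_hom_def matrix_colimit_def matrix_cocone_def)
    then show "x \<in> \<iota> (Suc j) ` cmats (n (Suc j))" by blast
  qed
  then have "incseq (\<lambda>j. \<iota> j ` cmats (n j))" by (rule incseq_SucI)
  moreover have "matrix_subalgebra (\<iota> j ` cmats (n j)) (n j) (\<lambda>a b. \<iota> j (matrix_unit (n j) a b))" for j
    using colim by (intro matrix_subalgebra_image) (simp add: matrix_colimit_def matrix_cocone_def)
  ultimately show thesis
    using colim n by (intro that[of "\<lambda>j. \<iota> j ` cmats (n j)" n]) (auto simp: matrix_colimit_def)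
qed

section \<open>Approximating loops of unitaries\<close>

text \<open>
  Choose a finite \<open>\<epsilon>/2\<close>-net for \<open>K\<close> in the dense union; as the chain increases, the net lies in one
  \<open>S j\<close>.  The map \<open>r\<close> averages the points of the net with weights \<open>w\<close> that are supported in the
  \<open>\<epsilon>/2\<close>-balls around them, so that \<open>r x\<close> is a convex combination of points that are close to \<open>x\<close>.
\<close>

lemma Schauder_projection:
  fixes S :: "nat \<Rightarrow> 'a::real_normed_vector set"
  assumes K: "compact K" and S: "incseq S" "\<And>j. convex (S j)" and dense: "closure (\<Union>j. S j) = UNIV"
    and \<epsilon>: "0 < \<epsilon>"
  obtains r j where "continuous_on K r" "\<And>x. x \<in> K \<Longrightarrow> r x \<in> S j" "\<And>x. x \<in> K \<Longrightarrow> dist x (r x) < \<epsilon>"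
proof -
  have "K \<subseteq> (\<Union>d\<in>(\<Union>j. S j). ball d (\<epsilon> / 2))"
  proof
    fix x :: 'a
    have "x \<in> closure (\<Union>j. S j)" using dense by simp
    then obtain d where "d \<in> (\<Union>j. S j)" "dist d x < \<epsilon> / 2"
      using \<epsilon> half_gt_zero unfolding closure_approachable by blast
    then show "x \<in> (\<Union>d\<in>(\<Union>j. S j). ball d (\<epsilon> / 2))" by auto
  qed
  then obtain P where P: "P \<subseteq> (\<Union>j. S j)" "finite P" "K \<subseteq> (\<Union>d\<in>P. ball d (\<epsilon> / 2))"
    using compactE_image[OF K, of "\<Union>j. S j" "\<lambda>d. ball d (\<epsilon> / 2)"] by (metis open_ball)
  have "\<exists>j. P \<subseteq> S j" using P(2,1)
  proof (induction P)
    case (insert d P)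
    then obtain i j where "P \<subseteq> S i" "d \<in> S j" by auto
    moreover have "S i \<subseteq> S (max i j)" "S j \<subseteq> S (max i j)" using incseqD[OF S(1)] by auto
    ultimately show ?case by blast
  qed auto
  then obtain j where j: "P \<subseteq> S j" by blast
  define h where "h d x = max 0 (\<epsilon> / 2 - dist d x)" for d x :: 'a
  define w where "w d x = h d x / (\<Sum>d\<in>P. h d x)" for d x
  define r where "r x = (\<Sum>d\<in>P. w d x *\<^sub>R d)" for x
  have h_nonneg: "0 \<le> h d x" for d x by (simp add: h_def)
  have pos: "0 < (\<Sum>d\<in>P. h d x)" if "x \<in> K" for x
  proof -
    obtain d where "d \<in> P" "dist d x < \<epsilon> / 2" using P(3) \<open>x \<in> K\<close> by auto
    then have "d \<in> P" "0 < h d x" by (auto simp: h_def)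
    then show ?thesis using P(2) h_nonneg by (intro sum_pos2[of _ d]) auto
  qed
  have w_nonneg: "0 \<le> w d x" if "x \<in> K" for d x
    using h_nonneg[of d x] pos[OF that] by (simp add: w_def)
  have w_sum: "(\<Sum>d\<in>P. w d x) = 1" if "x \<in> K" for x
    using pos[OF that] by (simp add: w_def sum_divide_distrib[symmetric])
  show thesis
  proof (rule that)
    have "continuous_on K (\<lambda>x. \<Sum>d\<in>P. h d x)" "continuous_on K (h d)" for d
      unfolding h_def by (intro continuous_intros)+
    then show "continuous_on K r"
      unfolding r_def w_def using pos by (intro continuous_intros) (auto simp: less_imp_neq[symmetric])
    show "r x \<in> S j" if "x \<in> K" for x
      unfolding r_def using j w_nonneg[OF that] w_sum[OF that] by (intro convex_sum P(2) S(2)) auto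
    show "dist x (r x) < \<epsilon>" if x: "x \<in> K" for x
    proof -
      have "(\<Sum>d\<in>P. w d x *\<^sub>R (x - d)) = (\<Sum>d\<in>P. w d x) *\<^sub>R x - r x"
        by (simp only: scaleR_diff_right sum_subtractf scaleR_sum_left r_def)
      then have "dist x (r x) = norm (\<Sum>d\<in>P. w d x *\<^sub>R (x - d))"
        by (simp add: w_sum[OF x] dist_norm)
      also have "\<dots> \<le> (\<Sum>d\<in>P. w d x * (\<epsilon> / 2))"
      proof (rule sum_norm_le)
        fix d
        have "w d x * dist d x \<le> w d x * (\<epsilon> / 2)"
        proof (cases "dist d x \<le> \<epsilon> / 2")
          case True
          then show ?thesis using w_nonneg[OF x] by (rule mult_left_mono)
        next
          case False
          then have "w d x = 0" by (simp add: w_def h_def)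
          then show ?thesis by simp
        qed
        then show "norm (w d x *\<^sub>R (x - d)) \<le> w d x * (\<epsilon> / 2)"
          using w_nonneg[OF x, of d] by (simp add: dist_norm norm_minus_commute)
      qed
      also have "\<dots> = \<epsilon> / 2" by (simp only: sum_distrib_right[symmetric] w_sum[OF x] mult_1_left)
      finally show ?thesis using \<epsilon> by simp
    qed
  qed
qed

lemma (in matrix_subalgebra) convex_S: "convex S"
  by (auto simp: convex_def scaleR_scaleC intro!: add_closed scaleC_closed)

text \<open>
  \<open>F\<close> need not be uniformly continuous on \<open>N\<close>; a Lebesgue number of a cover of \<open>K\<close> gives the
  uniformity at the points of \<open>K\<close> only, which is what \<open>has_degree_close\<close> asks for.
\<close>

lemma compact_relative_approximation:
  fixes F :: "'a::metric_space \<Rightarrow> 'b::real_normed_vector"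
  assumes K: "compact K" "K \<subseteq> N" and N: "open N" and F: "continuous_on N F" "\<And>x. x \<in> K \<Longrightarrow> F x \<noteq> 0"
  obtains \<epsilon> where "0 < \<epsilon>" "\<And>x y. x \<in> K \<Longrightarrow> dist x y < \<epsilon> \<Longrightarrow> y \<in> N \<and> norm (F y - F x) < norm (F x)"
proof -
  \<comment> \<open>two points \<open>x\<close> and \<open>y\<close> of \<open>G k\<close> differ by less than \<open>2/3 * norm (F k)\<close>, hence less than \<open>norm (F x)\<close>\<close>
  define G where "G k = {x \<in> N. norm (F x - F k) < norm (F k) / 3}" for k
  have "open (G k)" for k
  proof -
    have "G k = N \<inter> F -` ball (F k) (norm (F k) / 3)"
      by (auto simp: G_def dist_norm norm_minus_commute)
    then show ?thesis using continuous_open_preimage[OF F(1) N open_ball] by simp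
  qed
  moreover have "K \<subseteq> \<Union>(G ` K)" using K(2) F(2) by (auto simp: G_def)
  ultimately obtain \<epsilon> where \<epsilon>: "0 < \<epsilon>" "\<And>x. x \<in> K \<Longrightarrow> \<exists>B\<in>G ` K. ball x \<epsilon> \<subseteq> B"
    using Heine_Borel_lemma[OF K(1), of "G ` K"] by (metis imageE)
  show thesis
  proof (rule that[OF \<epsilon>(1)])
    fix x y assume xy: "x \<in> K" "dist x y < \<epsilon>"
    then obtain k where "ball x \<epsilon> \<subseteq> G k" using \<epsilon>(2) by blast
    then have "x \<in> G k" "y \<in> G k" using xy \<epsilon>(1) by (auto simp: subset_iff)
    then have x: "norm (F x - F k) < norm (F k) / 3" and y: "norm (F y - F k) < norm (F k) / 3" "y \<in> N"
      by (auto simp: G_def)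
    have "norm (F y - F x) \<le> norm (F y - F k) + norm (F x - F k)"
      by (metis norm_triangle_ineq4 diff_diff_eq2 diff_add_cancel add_diff_cancel_right')
    moreover have "norm (F k) \<le> norm (F x) + norm (F x - F k)"
      by (metis norm_triangle_sub norm_minus_commute)
    ultimately show "y \<in> N \<and> norm (F y - F x) < norm (F x)" using x y by simp
  qed
qed

text \<open>
  The Schauder projection moves the loop into some \<open>S j\<close>, and the unitary part makes it unitary again.
  That the new loop lies in \<open>S j\<close> is expressed by commutation with the commutant of \<open>S j\<close>, a property
  that passes to limits and so survives the inverse square root.
\<close>

lemma loop_into_matrix_subalgebra:
  fixes f :: "'a::cstar_algebra_1 \<Rightarrow> complex" and S :: "nat \<Rightarrow> 'a set"
  assumes S: "\<And>j. matrix_subalgebra (S j) (n j) (e j)" "incseq S" "closure (\<Union>j. S j) = UNIV"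
    and f: "continuous_on unitaries f" "\<And>U. U \<in> unitaries \<Longrightarrow> f U \<noteq> 0"
    and \<gamma>: "continuous_on {0..1} \<gamma>" "\<gamma> ` {0..1} \<subseteq> unitaries" "\<gamma> 0 = \<gamma> 1"
    and d: "has_degree (\<lambda>t. f (\<gamma> t)) d"
  obtains j \<eta> where "continuous_on {0..1} \<eta>" "\<eta> ` {0..1} \<subseteq> unitaries" "\<eta> 0 = \<eta> 1"
    "\<forall>b. (\<forall>x\<in>S j. b * x = x * b) \<longrightarrow> (\<forall>t\<in>{0..1}. b * \<eta> t = \<eta> t * b)"
    "has_degree (\<lambda>t. f (\<eta> t)) d"
proof -
  define K where "K = \<gamma> ` {0..1}"
  define F where "F x = f (unitary_part x)" for x
  have K: "compact K" "K \<subseteq> unitaries" using \<gamma> by (auto simp: K_def intro!: compact_continuous_image)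
  have F: "continuous_on almost_unitaries F"
    unfolding F_def
    by (rule continuous_on_compose2[OF f(1) continuous_on_unitary_part]) (auto intro: unitary_part_in_unitaries)
  have F_nz: "F x \<noteq> 0" if "x \<in> K" for x using that K(2) f(2) by (auto simp: F_def unitary_part_unitary)
  have KN: "K \<subseteq> almost_unitaries" using K(2) unitaries_subset_almost by blast
  obtain \<epsilon> where \<epsilon>: "0 < \<epsilon>"
    "\<And>x y. x \<in> K \<Longrightarrow> dist x y < \<epsilon> \<Longrightarrow> y \<in> almost_unitaries \<and> norm (F y - F x) < norm (F x)"
    using compact_relative_approximation[OF K(1) KN open_almost_unitaries F F_nz] by blast
  obtain r j where r: "continuous_on K r" "\<And>x. x \<in> K \<Longrightarrow> r x \<in> S j" "\<And>x. x \<in> K \<Longrightarrow> dist x (r x) < \<epsilon>"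
    using Schauder_projection[OF K(1) S(2) matrix_subalgebra.convex_S[OF S(1)] S(3) \<epsilon>(1)] by metis
  define \<eta> where "\<eta> t = unitary_part (r (\<gamma> t))" for t
  have \<gamma>K: "\<gamma> t \<in> K" if "t \<in> {0..1}" for t using that by (auto simp: K_def)
  have au: "r (\<gamma> t) \<in> almost_unitaries" if "t \<in> {0..1}" for t using \<epsilon>(2)[OF \<gamma>K r(3)[OF \<gamma>K]] that by blast
  have cont: "continuous_on {0..1} \<eta>"
    unfolding \<eta>_def
    by (intro continuous_on_compose2[OF continuous_on_unitary_part] continuous_on_compose2[OF r(1)] \<gamma>(1))
       (use au \<gamma>K in auto)
  have \<eta>_unitary: "\<eta> ` {0..1} \<subseteq> unitaries" using au by (auto simp: \<eta>_def intro!: unitary_part_in_unitaries)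
  have loop: "\<eta> 0 = \<eta> 1" by (simp add: \<eta>_def \<gamma>(3))
  have commute: "b * \<eta> t = \<eta> t * b" if t: "t \<in> {0..1}" and b: "\<And>x. x \<in> S j \<Longrightarrow> b * x = x * b" for b t
    unfolding \<eta>_def
    by (rule unitary_part_commute[OF au[OF t]])
       (use b r(2)[OF \<gamma>K[OF t]] matrix_subalgebra.star_closed[OF S(1)] in auto)
  have "has_degree (\<lambda>t. f (\<eta> t)) d"
  proof (rule has_degree_close[OF _ _ _ _ _ d])
    show "continuous_on {0..1} (\<lambda>t. f (\<gamma> t))" "continuous_on {0..1} (\<lambda>t. f (\<eta> t))"
      using continuous_on_compose2[OF f(1)] \<gamma>(1,2) cont \<eta>_unitary by blast+
    show "norm (f (\<eta> t) - f (\<gamma> t)) < norm (f (\<gamma> t))" if "t \<in> {0..1}" for t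
    proof -
      have "F (\<gamma> t) = f (\<gamma> t)" using \<gamma>K[OF that] K(2) by (auto simp: F_def unitary_part_unitary)
      moreover have "F (r (\<gamma> t)) = f (\<eta> t)" by (simp add: F_def \<eta>_def)
      ultimately show ?thesis using \<epsilon>(2)[OF \<gamma>K[OF that] r(3)[OF \<gamma>K[OF that]]] by simp
    qed
  qed (use loop \<gamma>(3) in simp_all)
  then show thesis using that cont \<eta>_unitary loop commute by blast
qed

section \<open>Divisibility of degrees\<close>

lemma corner_unitary:
  fixes U p :: "'a::cstar_algebra_1"
  assumes U: "U \<in> unitaries" and p: "star p = p" "p * p = p" and comm: "U * p = p * U"
  shows "U * p + (1 - p) \<in> unitaries"
proof -
  have comm': "star U * p = p * star U" using arg_cong[OF comm, of star] p(1) by (simp add: star_mult)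
  have pU: "p * (U * x) = U * (p * x)" and pU': "p * (star U * x) = star U * (p * x)"
    and pp: "p * (p * x) = p * x" and UU: "U * (star U * x) = x" "star U * (U * x) = x" for x
    using comm comm' p(2) unitariesD[OF U] by (simp_all flip: mult.assoc)
  have "star (U * p + (1 - p)) = star U * p + (1 - p)"
    by (simp add: star_add star_diff star_mult p(1) comm')
  then show ?thesis
    by (simp add: unitaries_def distrib_left distrib_right left_diff_distrib right_diff_distrib mult.assoc
        p(2) comm[symmetric] comm'[symmetric] pU pU' pp UU unitariesD[OF U])
qed

text \<open>
  On the range of \<open>P\<close> the element \<open>J\<close> is a complex structure, so that \<open>c P + s J\<close> is a rotation there.
\<close>

lemma rotation_unitary:
  fixes P J :: "'a::cstar_algebra_1"
  assumes "star P = P" "star J = - J" "P * P = P" "P * J = J" "J * P = J" "J * J = - P"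
    and cs: "c\<^sup>2 + s\<^sup>2 = 1"
  shows "c *\<^sub>R P + s *\<^sub>R J + (1 - P) \<in> unitaries"
proof -
  have "star (c *\<^sub>R P + s *\<^sub>R J + (1 - P)) = c *\<^sub>R P - s *\<^sub>R J + (1 - P)"
    by (simp add: star_add star_diff star_scaleR assms)
  moreover have "(c *\<^sub>R P - s *\<^sub>R J + (1 - P)) * (c *\<^sub>R P + s *\<^sub>R J + (1 - P)) = (c\<^sup>2 + s\<^sup>2) *\<^sub>R P + (1 - P)"
    "(c *\<^sub>R P + s *\<^sub>R J + (1 - P)) * (c *\<^sub>R P - s *\<^sub>R J + (1 - P)) = (c\<^sup>2 + s\<^sup>2) *\<^sub>R P + (1 - P)"
    by (simp_all add: assms(1-6) distrib_left distrib_right left_diff_distrib right_diff_distrib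
        scaleR_add_left scaleR_add_right scaleR_diff_right power2_eq_square mult.commute[of s c])
  ultimately show ?thesis by (simp add: unitaries_def cs)
qed

text \<open>
  The loop is the product over \<open>a < r\<close> of its cut-downs \<open>\<alpha> (f a a)\<close>.  A rotation that mixes
  the ranges of \<open>f 0 0\<close> and \<open>f a a\<close> and commutes with the loop carries \<open>\<alpha> (f 0 0)\<close> to \<open>\<alpha> (f a a)\<close>, so all
  factors have the same degree \<open>d0\<close>, and the degrees of the factors add up to \<open>r * d0\<close>.
\<close>

lemma degree_divisible_based:
  fixes g :: "'a::cstar_algebra_1 \<Rightarrow> complex"
  assumes f: "matrix_units r f"
    and g: "continuous_on unitaries g" "\<And>U. U \<in> unitaries \<Longrightarrow> g U \<noteq> 0"
    and \<gamma>: "continuous_on {0..1} \<gamma>" "\<gamma> ` {0..1} \<subseteq> unitaries" "\<gamma> 0 = 1" "\<gamma> 1 = 1"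
    and comm: "\<And>a b t. a < r \<Longrightarrow> b < r \<Longrightarrow> t \<in> {0..1} \<Longrightarrow> f a b * \<gamma> t = \<gamma> t * f a b"
    and d: "has_degree (\<lambda>t. g (\<gamma> t)) d"
  shows "int r dvd d"
proof -
  have f_mult: "\<And>a b c d. a < r \<Longrightarrow> b < r \<Longrightarrow> c < r \<Longrightarrow> d < r \<Longrightarrow> f a b * f c d = (if b = c then f a d else 0)"
    and f_star: "\<And>a b. a < r \<Longrightarrow> b < r \<Longrightarrow> star (f a b) = f b a" and f_sum: "(\<Sum>a<r. f a a) = 1"
    using f by (auto simp: matrix_units_def)
  have r: "0 < r" using f_sum by (cases r) auto
  have \<gamma>_unitary: "\<gamma> t \<in> unitaries" if "t \<in> {0..1}" for t using \<gamma>(2) that by blast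
  define \<alpha> where "\<alpha> p t = \<gamma> t * p + (1 - p)" for p t
  have \<alpha>_cont: "continuous_on {0..1} (\<alpha> p)" for p
    unfolding \<alpha>_def by (intro continuous_intros \<gamma>(1))
  have \<alpha>_ends: "\<alpha> p 0 = 1" "\<alpha> p 1 = 1" for p by (simp_all add: \<alpha>_def \<gamma>(3,4))
  have \<alpha>_unitary: "\<alpha> p t \<in> unitaries" if "star p = p" "p * p = p" "\<gamma> t * p = p * \<gamma> t" "t \<in> {0..1}" for p t
    unfolding \<alpha>_def using that \<gamma>_unitary by (intro corner_unitary) auto
  have diag: "star (f a a) = f a a" "f a a * f a a = f a a" if "a < r" for a
    using that by (simp_all add: f_star f_mult)
  have diag_unitary: "\<alpha> (f a a) t \<in> unitaries" if "a < r" "t \<in> {0..1}" for a t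
    using that comm by (intro \<alpha>_unitary diag) auto
  have g_cont: "continuous_on A (\<lambda>x. g (h x))"
    if "continuous_on A h" "\<And>x. x \<in> A \<Longrightarrow> h x \<in> unitaries" for A :: "'b::topological_space set" and h
    using continuous_on_compose2[OF g(1) that(1)] that(2) by blast
  obtain d0 where d0: "has_degree (\<lambda>t. g (\<alpha> (f 0 0) t)) d0"
  proof (rule has_degree_exists)
    show "continuous_on {0..1} (\<lambda>t. g (\<alpha> (f 0 0) t))"
      using r by (intro g_cont \<alpha>_cont diag_unitary)
  qed (use r g(2) diag_unitary \<alpha>_ends in auto)
  have deg_diag: "has_degree (\<lambda>t. g (\<alpha> (f a a) t)) d0" if a: "a < r" for a
  proof (cases "a = 0")
    case False
    define P where "P = f 0 0 + f a a"
    define J where "J = f a 0 - f 0 a"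
    define W where "W s = cos (pi / 2 * s) *\<^sub>R P + sin (pi / 2 * s) *\<^sub>R J + (1 - P)" for s
    have W_unitary: "W s \<in> unitaries" for s
      unfolding W_def
      by (rule rotation_unitary)
         (use a r False in \<open>simp_all add: P_def J_def star_add star_diff f_star f_mult algebra_simps\<close>)
    have W_cont: "continuous_on A W" for A unfolding W_def by (intro continuous_intros)
    have W_comm: "W s * \<gamma> t = \<gamma> t * W s" if "t \<in> {0..1}" for s t
      using a r that by (simp add: W_def P_def J_def comm algebra_simps)
    have W1: "W 1 * f 0 0 = f a 0" using a r False by (simp add: W_def P_def J_def f_mult algebra_simps)
    have W1': "f a 0 * star (W 1) = f a a"
      using a r False by (simp add: W_def P_def J_def star_add star_diff f_star f_mult algebra_simps)
    define \<Phi> where "\<Phi> = (\<lambda>(s, t). g (W s * \<alpha> (f 0 0) t * star (W s)))"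
    have in_unitaries: "W s * \<alpha> (f 0 0) t * star (W s) \<in> unitaries" if "t \<in> {0..1}" for s t
      using r that by (intro unitaries_mult unitaries_star W_unitary diag_unitary)
    have "has_degree (\<lambda>t. \<Phi> (1, t)) d0"
    proof (rule has_degree_homotopy)
      show "continuous_on ({0..1} \<times> {0..1}) \<Phi>"
        unfolding \<Phi>_def case_prod_beta
        by (intro g_cont continuous_intros continuous_on_compose2[OF continuous_on_star]
              continuous_on_compose2[OF W_cont] continuous_on_compose2[OF \<alpha>_cont])
           (use in_unitaries in auto)
      show "\<Phi> p \<noteq> 0" if "p \<in> {0..1} \<times> {0..1}" for p
        using g(2) in_unitaries that by (auto simp: \<Phi>_def)
      show "\<Phi> (s, 0) = \<Phi> (s, 1)" if "s \<in> {0..1}" for s by (simp add: \<Phi>_def \<alpha>_ends)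
      have "W 0 = 1" by (simp add: W_def)
      then show "has_degree (\<lambda>t. \<Phi> (0, t)) d0" using d0 by (simp add: \<Phi>_def)
    qed
    moreover have "\<Phi> (1, t) = g (\<alpha> (f a a) t)" if t: "t \<in> {0..1}" for t
    proof -
      have "W 1 * \<alpha> (f 0 0) t * star (W 1)
          = \<gamma> t * (W 1 * f 0 0 * star (W 1)) + (W 1 * star (W 1) - W 1 * f 0 0 * star (W 1))"
        using W_comm[OF t, of 1]
        by (simp add: \<alpha>_def distrib_left distrib_right left_diff_distrib right_diff_distrib) (simp flip: mult.assoc)
      then show ?thesis by (simp add: \<Phi>_def \<alpha>_def W1 W1' unitariesD[OF W_unitary])
    qed
    ultimately show ?thesis by (auto intro: has_degree_cong)
  qed (use d0 in simp)
  \<comment> \<open>the product of the first \<open>k\<close> factors is \<open>\<alpha> (Q k)\<close>\<close>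
  define Q where "Q k = (\<Sum>a<k. f a a)" for k
  have Q_star: "star (Q k) = Q k" if "k \<le> r" for k
    using that by (simp add: Q_def star_sum f_star)
  have Q_orth: "Q k * f k k = 0" if "k < r" for k
    using that by (simp add: Q_def sum_distrib_right f_mult)
  have Q_idem: "Q k * Q k = Q k" if "k \<le> r" for k
    using that by (simp add: Q_def sum_product f_mult sum.delta)
  have Q_comm: "Q k * \<gamma> t = \<gamma> t * Q k" if "k \<le> r" "t \<in> {0..1}" for k t
    using that by (simp add: Q_def sum_distrib_left sum_distrib_right comm)
  have Q_unitary: "\<alpha> (Q k) t \<in> unitaries" if "k \<le> r" "t \<in> {0..1}" for k t
    using that by (intro \<alpha>_unitary) (auto simp: Q_star Q_idem Q_comm)
  have "has_degree (\<lambda>t. g (\<alpha> (Q k) t)) (int k * d0)" if "k \<le> r" for k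
    using that
  proof (induction k)
    case 0
    have "has_degree (\<lambda>t. g 1) 0"
      unfolding has_degree_def using g(2)[of 1] by (intro exI[of _ "\<lambda>t. Ln (g 1)"]) auto
    then show ?case by (simp add: Q_def \<alpha>_def)
  next
    case (Suc k)
    then have k: "k < r" by simp
    define \<Phi> where "\<Phi> = (\<lambda>(s, t). g (\<alpha> (Q k) s * \<alpha> (f k k) t))"
    have in_unitaries: "\<alpha> (Q k) s * \<alpha> (f k k) t \<in> unitaries" if "s \<in> {0..1}" "t \<in> {0..1}" for s t
      using k that by (intro unitaries_mult Q_unitary diag_unitary) auto
    have "has_degree (\<lambda>t. \<Phi> (t, t)) (int k * d0 + d0)"
    proof (rule has_degree_diagonal)
      show "continuous_on ({0..1} \<times> {0..1}) \<Phi>"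
        unfolding \<Phi>_def case_prod_beta
        by (intro g_cont continuous_intros continuous_on_compose2[OF \<alpha>_cont]) (use in_unitaries in auto)
      show "\<Phi> p \<noteq> 0" if "p \<in> {0..1} \<times> {0..1}" for p
        using g(2) in_unitaries that by (auto simp: \<Phi>_def)
      show "\<Phi> (s, 0) = \<Phi> (s, 1)" if "s \<in> {0..1}" for s by (simp add: \<Phi>_def \<alpha>_ends)
      show "has_degree (\<lambda>s. \<Phi> (s, 0)) (int k * d0)" using Suc by (simp add: \<Phi>_def \<alpha>_ends)
      show "has_degree (\<lambda>t. \<Phi> (0, t)) d0" using deg_diag[OF k] by (simp add: \<Phi>_def \<alpha>_ends)
    qed
    moreover have "\<Phi> (t, t) = g (\<alpha> (Q (Suc k)) t)" if t: "t \<in> {0..1}" for t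
    proof -
      have 1: "Q k * (\<gamma> t * f k k) = 0"
      proof -
        have "Q k * (\<gamma> t * f k k) = \<gamma> t * (Q k * f k k)"
          using Q_comm[of k t] k t by (simp flip: mult.assoc)
        then show ?thesis by (simp add: Q_orth[OF k])
      qed
      have "\<alpha> (Q k) t * \<alpha> (f k k) t = \<alpha> (Q k + f k k) t"
        by (simp add: \<alpha>_def distrib_left distrib_right left_diff_distrib right_diff_distrib mult.assoc
            1 Q_orth[OF k])
      then show ?thesis by (simp add: \<Phi>_def Q_def)
    qed
    ultimately have "has_degree (\<lambda>t. g (\<alpha> (Q (Suc k)) t)) (int k * d0 + d0)"
      by (auto intro: has_degree_cong)
    then show ?case by (simp add: algebra_simps)
  qed
  from this[of r] have "has_degree (\<lambda>t. g (\<gamma> t)) (int r * d0)" by (simp add: Q_def f_sum \<alpha>_def)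
  then have "d = int r * d0" using d has_degree_unique by blast
  then show ?thesis by simp
qed

text \<open>
  Left translation by \<open>star (\<gamma> 0)\<close> reduces this to loops based at 1.
\<close>

lemma degree_divisible:
  fixes g :: "'a::cstar_algebra_1 \<Rightarrow> complex"
  assumes f: "matrix_units r f"
    and g: "continuous_on unitaries g" "\<And>U. U \<in> unitaries \<Longrightarrow> g U \<noteq> 0"
    and \<gamma>: "continuous_on {0..1} \<gamma>" "\<gamma> ` {0..1} \<subseteq> unitaries" "\<gamma> 0 = \<gamma> 1"
    and comm: "\<And>a b t. a < r \<Longrightarrow> b < r \<Longrightarrow> t \<in> {0..1} \<Longrightarrow> f a b * \<gamma> t = \<gamma> t * f a b"
    and d: "has_degree (\<lambda>t. g (\<gamma> t)) d"
  shows "int r dvd d"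
proof (rule degree_divisible_based[OF f, of "\<lambda>U. g (\<gamma> 0 * U)" "\<lambda>t. star (\<gamma> 0) * \<gamma> t"])
  have u: "\<gamma> 0 \<in> unitaries" using \<gamma>(2) by auto
  show "continuous_on unitaries (\<lambda>U. g (\<gamma> 0 * U))"
    by (rule continuous_on_compose2[OF g(1)]) (auto intro!: continuous_intros unitaries_mult u)
  show "g (\<gamma> 0 * U) \<noteq> 0" if "U \<in> unitaries" for U using g(2) unitaries_mult[OF u that] by blast
  show "continuous_on {0..1} (\<lambda>t. star (\<gamma> 0) * \<gamma> t)" by (intro continuous_intros \<gamma>(1))
  show "(\<lambda>t. star (\<gamma> 0) * \<gamma> t) ` {0..1} \<subseteq> unitaries"
    using \<gamma>(2) by (auto intro!: unitaries_mult unitaries_star u)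
  show "star (\<gamma> 0) * \<gamma> 0 = 1" "star (\<gamma> 0) * \<gamma> 1 = 1" using unitariesD[OF u] \<gamma>(3) by simp_all
  show "has_degree (\<lambda>t. g (\<gamma> 0 * (star (\<gamma> 0) * \<gamma> t))) d"
    using d by (simp add: mult.assoc[symmetric] unitariesD[OF u])
  show "f a b * (star (\<gamma> 0) * \<gamma> t) = star (\<gamma> 0) * \<gamma> t * f a b" if "a < r" "b < r" "t \<in> {0..1}" for a b t
  proof -
    have "star (f b a * \<gamma> 0) = star (\<gamma> 0 * f b a)" using comm[of b a 0] that by simp
    then have "star (\<gamma> 0) * f a b = f a b * star (\<gamma> 0)"
      using f that by (simp add: star_mult matrix_units_def)
    then show ?thesis using comm[OF that] by (metis mult.assoc)
  qed
qed

text \<open>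
  Fix a loop in the \<open>j\<close>-th matrix algebra of the same degree.  Its degree is divisible by \<open>n m div n j\<close>
  for every \<open>m \<ge> j\<close>, and these quotients are unbounded.
\<close>

theorem UHF_unitary_loop_degree_0:
  fixes f :: "'a::cstar_algebra_1 \<Rightarrow> complex"
  assumes UHF: "UHF_algebra TYPE('a)"
    and f: "continuous_on unitaries f" "\<And>U. U \<in> unitaries \<Longrightarrow> f U \<noteq> 0"
    and \<gamma>: "continuous_on {0..1} \<gamma>" "\<gamma> ` {0..1} \<subseteq> unitaries" "\<gamma> 0 = \<gamma> 1"
    and d: "has_degree (\<lambda>t. f (\<gamma> t)) d"
  shows "d = 0"
proof (rule ccontr)
  assume "d \<noteq> 0"
  obtain S :: "nat \<Rightarrow> 'a set" and n e where
    "\<forall>j. matrix_subalgebra (S j) (n j) (e j)" and S: "incseq S" "closure (\<Union>j. S j) = UNIV"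
    and n: "filterlim n at_top sequentially"
    by (rule UHF_algebra_matrix_subalgebras[OF UHF])
  then have Sj: "matrix_subalgebra (S j) (n j) (e j)" for j by blast
  obtain j \<eta> where \<eta>: "continuous_on {0..1} \<eta>" "\<eta> ` {0..1} \<subseteq> unitaries" "\<eta> 0 = \<eta> 1"
    and comm: "\<forall>b. (\<forall>x\<in>S j. b * x = x * b) \<longrightarrow> (\<forall>t\<in>{0..1}. b * \<eta> t = \<eta> t * b)"
    and d': "has_degree (\<lambda>t. f (\<eta> t)) d"
    by (rule loop_into_matrix_subalgebra[OF Sj S f \<gamma> d])
  have "\<forall>\<^sub>F m in sequentially. Suc (nat \<bar>d\<bar> * n j) \<le> n m"
    using n unfolding filterlim_at_top by blast
  then have "\<forall>\<^sub>F m in sequentially. Suc (nat \<bar>d\<bar> * n j) \<le> n m \<and> j \<le> m"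
    using eventually_ge_at_top by (rule eventually_conj)
  then obtain m where m: "nat \<bar>d\<bar> * n j < n m" "j \<le> m"
    by (auto simp: eventually_sequentially Suc_le_eq)
  obtain r F where F: "matrix_units r F" "n m = r * n j"
    "\<forall>a<r. \<forall>b<r. \<forall>x\<in>S j. F a b * x = x * F a b"
    by (rule commutant_matrix_units[OF Sj Sj incseqD[OF S(1) m(2)]])
  have "int r dvd d"
    by (rule degree_divisible[OF F(1) f \<eta> _ d']) (use comm F(3) in auto)
  then have "int r \<le> \<bar>d\<bar>" using \<open>d \<noteq> 0\<close> by (intro zdvd_imp_le) auto
  then have "r * n j \<le> nat \<bar>d\<bar> * n j" by (intro mult_right_mono) auto
  then show False using m F(2) by simp
qed

section \<open>The isotropy group of a pure state\<close>

lemma pure_state_component: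
  assumes pure: "pure_state \<omega>" and st: "\<rho> \<in> states" "\<sigma> \<in> states" and mid: "\<omega> = (1 / 2) *\<^sub>R \<rho> + (1 / 2) *\<^sub>R \<sigma>"
  shows "\<rho> = \<omega>"
proof (rule ccontr)
  assume "\<rho> \<noteq> \<omega>"
  have "\<rho> \<noteq> \<sigma>"
  proof
    assume "\<rho> = \<sigma>"
    then have "\<omega> = (1 / 2 + 1 / 2 :: real) *\<^sub>R \<rho>" using mid by (simp only: scaleR_add_left)
    then show False using \<open>\<rho> \<noteq> \<omega>\<close> by simp
  qed
  then have "\<omega> \<in> open_segment \<rho> \<sigma>"
    unfolding in_segment by (intro conjI exI[of _ "1 / 2"]) (simp_all add: mid)
  then show False using pure st by (auto simp: pure_state_def extreme_point_of_def)
qed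

text \<open>
  In the GNS representation a unitary \<open>V\<close> that fixes the pure state \<open>\<omega>\<close> has the cyclic vector as an
  eigenvector, so \<open>\<omega> V\<close> is the eigenvalue.  The following argument avoids the representation.  Suppose
  \<open>\<omega> V = 0\<close>.  For \<open>cmod l = 1\<close> the state \<open>\<omega>\<close> is the midpoint of the normalized vector states of
  \<open>1 + l V\<close> and \<open>1 - l V\<close>, so by purity both are equal to \<open>\<omega>\<close>.  The cross terms of the
  first one therefore vanish, and \<open>l = 1\<close> and \<open>l = \<i>\<close> together give \<open>\<omega> (x * V) = 0\<close> for all \<open>x\<close>;
  for \<open>x = star V\<close> this contradicts \<open>\<omega> 1 = 1\<close>.
\<close>

lemma isotropy_nonzero:
  fixes \<omega> :: "'a::cstar_algebra_1 \<Rightarrow>\<^sub>L complex"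
  assumes pure: "pure_state \<omega>" and V: "V \<in> isotropy \<omega>"
  shows "blinfun_apply \<omega> V \<noteq> 0"
proof
  assume V0: "blinfun_apply \<omega> V = 0"
  have st: "\<omega> \<in> states" using pure by (simp add: pure_state_def extreme_point_of_def)
  then have scale: "\<And>c x. blinfun_apply \<omega> (c *\<^sub>C x) = c * blinfun_apply \<omega> x"
    and pos: "\<And>x. blinfun_apply \<omega> (star x * x) \<in> \<real>\<^sub>\<ge>\<^sub>0" and one: "blinfun_apply \<omega> 1 = 1"
    by (auto simp: states_def)
  have V_unitary: "star V * V = 1" "V * star V = 1" and V_inv: "act V \<omega> = \<omega>"
    using V by (auto simp: isotropy_def unitaries_def)
  have inv: "blinfun_apply \<omega> (star V * x * V) = blinfun_apply \<omega> x" for x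
    using blinfun_apply_act[of V \<omega> x] V_inv by simp
  have expand: "star (1 + l *\<^sub>C V) * x * (1 + l *\<^sub>C V) =
      x + l *\<^sub>C (x * V) + cnj l *\<^sub>C (star V * x) + (cnj l * l) *\<^sub>C (star V * x * V)" for l x
    by (simp add: star_add star_scaleC distrib_left distrib_right mult_scaleC_left mult_scaleC_right
        scaleC_add_right scaleC_scaleC mult.assoc mult.commute[of l])
  have twisted: "blinfun_apply \<omega> (star (1 + l *\<^sub>C V) * x * (1 + l *\<^sub>C V)) =
      2 * blinfun_apply \<omega> x + l * blinfun_apply \<omega> (x * V) + cnj l * blinfun_apply \<omega> (star V * x)"
    if "cnj l * l = 1" for l x
    unfolding expand that by (simp add: blinfun.add_right scale inv)
  have Vs0: "blinfun_apply \<omega> (star V) = 0"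
  proof -
    have "blinfun_apply \<omega> (star (1 + l *\<^sub>C V) * (1 + l *\<^sub>C V)) \<in> \<real>" for l
      using pos by (metis nonneg_Reals_subset_Reals subsetD)
    from this[of 1] this[of \<i>] have "blinfun_apply \<omega> (star V) \<in> \<real>" "\<i> * blinfun_apply \<omega> (star V) \<in> \<real>"
      using twisted[of 1 1] twisted[of \<i> 1] V0 one by (auto simp: complex_is_Real_iff)
    then show ?thesis by (auto simp: complex_is_Real_iff complex_eq_iff)
  qed
  have half_state: "(1 / 2) *\<^sub>R act (1 + l *\<^sub>C V) \<omega> \<in> states" if l: "cnj l * l = 1" for l
  proof -
    have "blinfun_apply \<omega> (star (1 + l *\<^sub>C V) * (star x * x) * (1 + l *\<^sub>C V)) \<in> \<real>\<^sub>\<ge>\<^sub>0" for x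
      using pos[of "x * (1 + l *\<^sub>C V)"] by (simp only: star_mult mult.assoc)
    then have "(1 / 2) *\<^sub>R blinfun_apply \<omega> (star (1 + l *\<^sub>C V) * (star x * x) * (1 + l *\<^sub>C V)) \<in> \<real>\<^sub>\<ge>\<^sub>0" for x
      by (auto simp: complex_nonneg_Reals_iff)
    moreover have "blinfun_apply \<omega> (star (1 + l *\<^sub>C V) * 1 * (1 + l *\<^sub>C V)) = 2"
      using twisted[OF l, of 1] V0 Vs0 one by simp
    moreover have "(1 / 2) *\<^sub>R (2::complex) = 1" by (simp add: scaleR_conv_of_real)
    ultimately show ?thesis
      by (simp add: states_def blinfun.scaleR_left mult_scaleC_left mult_scaleC_right scale)
  qed
  have "l * blinfun_apply \<omega> (x * V) + cnj l * blinfun_apply \<omega> (star V * x) = 0" if l: "cnj l * l = 1" for l x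
  proof -
    have l': "cnj (- l) * (- l) = 1" using l by simp
    have "\<omega> = (1 / 2) *\<^sub>R ((1 / 2) *\<^sub>R act (1 + l *\<^sub>C V) \<omega>) + (1 / 2) *\<^sub>R ((1 / 2) *\<^sub>R act (1 + (- l) *\<^sub>C V) \<omega>)"
      by (rule blinfun_eqI)
         (simp only: blinfun.add_left blinfun.scaleR_left blinfun_apply_act twisted[OF l] twisted[OF l'];
          simp add: scaleR_conv_of_real field_simps)
    then have "(1 / 2) *\<^sub>R act (1 + l *\<^sub>C V) \<omega> = \<omega>"
      by (rule pure_state_component[OF pure half_state[OF l] half_state[OF l']])
    then have "(1 / 2) *\<^sub>R blinfun_apply (act (1 + l *\<^sub>C V) \<omega>) x = blinfun_apply \<omega> x"
      by (metis blinfun.scaleR_left)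
    then show ?thesis
      by (simp only: blinfun_apply_act twisted[OF l]) (simp add: scaleR_conv_of_real field_simps)
  qed
  from this[of 1 "star V"] this[of \<i> "star V"] have "blinfun_apply \<omega> (star V * V) = 0"
    by (simp add: algebra_simps)
  then show False using one V_unitary by simp
qed

section \<open>Nontriviality\<close>

theorem corollary3p18:
  fixes \<omega> :: "'a::cstar_algebra_1 \<Rightarrow>\<^sub>L complex"
  assumes "UHF_algebra TYPE('a)" and "infinite_dimensional TYPE('a)" and "pure_state \<omega>"
  shows "\<not> trivial_bundle (unitaries :: 'a set) (sector \<omega>) (isotropy \<omega>) (\<lambda>U. act U \<omega>)"
proof
  assume "trivial_bundle (unitaries :: 'a set) (sector \<omega>) (isotropy \<omega>) (\<lambda>U. act U \<omega>)"
  then obtain h g where "homeomorphism (unitaries :: 'a set) (sector \<omega> \<times> isotropy \<omega>) h g"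
    unfolding trivial_bundle_def by blast
  then have h: "continuous_on unitaries h" "h ` unitaries = sector \<omega> \<times> isotropy \<omega>"
    and g: "continuous_on (sector \<omega> \<times> isotropy \<omega>) g" "g ` (sector \<omega> \<times> isotropy \<omega>) = unitaries"
    and hg: "\<And>y. y \<in> sector \<omega> \<times> isotropy \<omega> \<Longrightarrow> h (g y) = y"
    by (auto simp: homeomorphism_def)
  have scale: "\<And>c x. blinfun_apply \<omega> (c *\<^sub>C x) = c * blinfun_apply \<omega> x" and one: "blinfun_apply \<omega> 1 = 1"
    using assms(3) by (auto simp: pure_state_def extreme_point_of_def states_def)
  \<comment> \<open>\<open>f\<close> is \<open>\<omega>\<close> on the fibre coordinate, and \<open>\<gamma>\<close> is the circle of scalars in the fibre over \<open>\<omega>\<close>\<close>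
  define f where "f U = blinfun_apply \<omega> (snd (h U))" for U
  define z where "z t = exp (2 * pi * \<i> * complex_of_real t)" for t
  define \<gamma> where "\<gamma> t = g (\<omega>, z t *\<^sub>C 1)" for t
  have "cmod (z t) = 1" for t by (simp add: z_def)
  then have zz: "z t * cnj (z t) = 1" "cnj (z t) * z t = 1" for t
    using complex_norm_square[of "z t"] by (simp_all add: mult.commute)
  have "act 1 \<omega> = \<omega>" by (rule blinfun_eqI) simp
  then have "\<omega> \<in> sector \<omega>" unfolding sector_def by (intro image_eqI[of _ _ 1]) simp_all
  moreover have "z t *\<^sub>C 1 \<in> isotropy \<omega>" for t
  proof -
    have "act (z t *\<^sub>C 1) \<omega> = \<omega>"
      by (rule blinfun_eqI) (simp add: star_scaleC mult_scaleC_left mult_scaleC_right scaleC_scaleC zz)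
    then show ?thesis
      by (simp add: isotropy_def unitaries_def star_scaleC mult_scaleC_left mult_scaleC_right scaleC_scaleC zz)
  qed
  ultimately have fibre: "(\<omega>, z t *\<^sub>C 1) \<in> sector \<omega> \<times> isotropy \<omega>" for t by simp
  have "continuous_on unitaries f"
    unfolding f_def by (intro continuous_intros h(1))
  moreover have "f U \<noteq> 0" if "U \<in> unitaries" for U
  proof -
    have "snd (h U) \<in> isotropy \<omega>" using h(2) that by (metis imageI mem_Times_iff)
    then show ?thesis unfolding f_def by (rule isotropy_nonzero[OF assms(3)])
  qed
  moreover have "continuous_on {0..1} \<gamma>"
  proof -
    have "continuous_on {0..1} (\<lambda>t. z t *\<^sub>C (1::'a))"
    proof -
      have "z t *\<^sub>C (1::'a) = Re (z t) *\<^sub>R 1 + Im (z t) *\<^sub>R (\<i> *\<^sub>C 1)" for t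
        by (simp add: scaleR_scaleC scaleC_scaleC scaleC_add_left[symmetric] complex_eq[symmetric] mult.commute)
      then show ?thesis unfolding z_def by (simp only:) (intro continuous_intros)
    qed
    then show ?thesis
      unfolding \<gamma>_def
      by (intro continuous_on_compose2[OF g(1)] continuous_intros) (use fibre in auto)
  qed
  moreover have "\<gamma> ` {0..1} \<subseteq> unitaries" using g(2) fibre by (auto simp: \<gamma>_def)
  moreover have "\<gamma> 0 = \<gamma> 1" by (simp add: \<gamma>_def z_def)
  moreover have "has_degree (\<lambda>t. f (\<gamma> t)) 1"
  proof -
    have "f (\<gamma> t) = z t" for t by (simp add: f_def \<gamma>_def hg[OF fibre] scale one)
    then show ?thesis using has_degree_cis by (simp only: z_def)
  qed
  ultimately have "(1::int) = 0" by (rule UHF_unitary_loop_degree_0[OF assms(1)])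
  then show False by simp
qed

end
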